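(* Let $V$ be a vertex algebra and let $M,N,W$ be $V$-modules such that the tensor product $M\otimes_VN$ exists. Then there are linear isomorphisms $$\binom{W}{M,N}\simeq V\text{-}\mathrm{Bilinear}(M,N;W)\simeq\mathrm{Hom}_V(M\otimes_VN,W)\simeq\mathrm{Hom}_V(M,\mathrm{Vhom}(N,W))\simeq\mathrm{Hom}_V(N,\mathrm{Vhom}^r(M,W)).$$
   Context: All vector spaces are over an algebraically closed field $\mathbf k$ of characteristic $0$. For $n\in\mathbb Z$, $(x+y)^n:=\sum_{k\ge 0}\binom nk x^{n-k}y^k$, i.e. binomials are expanded in nonnegative powers of the second-listed variable; a series evaluated at $z+x$, $x-y$, $-y+x$, etc. is expanded by this rule. $\delta(x,y):=\sum_{n\in\mathbb Z}x^ny^{-n-1}$, so $\delta(x-y,z)=\sum_n (x-y)^nz^{-n-1}$, etc. Vertex algebra: a vector space $V$ with a linear map $V\otimes V\to V((z))$, $a\otimes b\mapsto a_{\dot z}b=\sum_{n}(a_nb)z^{-n-1}$, a vector $\mathbf 1\in V$ and $d\in\mathrm{End}(V)$ such that for $a,b,c\in V$: $\mathbf 1_{\dot z}a=a$, $a_{\dot z}\mathbf 1=e^{zd}a$; $(da)_{\dot z}b=\frac{d}{dz}(a_{\dot z}b)$, $d(a_{\dot z}b)=(da)_{\dot z}b+a_{\dot z}(db)$; $a_{\dot z}b=e^{zd}(b_{\dot{-z}}a)$; and there is $l\in\mathbb N$ with $(z+w)^l(a_{\dot z}b)_{\dot w}c=(z+w)^l a_{\dot{z+w}}(b_{\dot w}c)$.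 $V$-module: a vector space $M$ with $d\in\mathrm{End}(M)$ and a linear map $V\otimes M\to M((z))$, $a\otimes u\mapsto a_{\dot z}u$, such that $\mathbf 1_{\dot z}u=u$; $(da)_{\dot z}u=\frac{d}{dz}(a_{\dot z}u)$, $d(a_{\dot z}u)=(da)_{\dot z}u+a_{\dot z}(du)$; and for all $a,b\in V$, $u\in M$ there is $l\in\mathbb N$ with $(z+x)^l(a_{\dot z}b)_{\dot x}u=(z+x)^la_{\dot{z+x}}(b_{\dot x}u)$. $\mathrm{Hom}_V(M,N)$ is the space of $V$-homomorphisms: linear maps $\varphi$ with $\varphi(a_{\dot z}u)=a_{\dot z}\varphi(u)$ and $\varphi(du)=d\varphi(u)$. $\binom{W}{M,N}$ is the space of intertwining operators of this type: bilinear maps $I_z:M\times N\to W((z))$ with $I_z(du,v)=\frac{d}{dz}I_z(u,v)$, $d(I_z(u,v))=I_z(du,v)+I_z(u,dv)$ and, for all $a\in V$, $\delta(x-y,z)\,a_{\dot x}I_y(u,v)-\delta(-y+x,z)\,I_y(u,a_{\dot x}v)=\delta(x-z,y)\,I_y(a_{\dot z}u,v)$. $V\text{-}\mathrm{Bilinear}(M,N;W)$ is the space of vertex bilinear maps of type $(M,N;W)$: bilinear maps $F_z:M\times N\to W((z))$ with $F_z(du,v)=\frac{d}{dz}F_z(u,v)$, $F_z(u,dv)=(d-\frac{d}{dz})F_z(u,v)$, and such that for all $a\in V,u\in M,v\in N$ there are $n,k\in\mathbb N$ with $(z+x)^na_{\dot{z+x}}F_x(u,v)=(z+x)^nF_x(a_{\dot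 z}u,v)$ and $(z-x)^ka_{\dot z}F_x(u,v)=(z-x)^kF_x(u,a_{\dot z}v)$. Tensor product of $(M,N)$: a $V$-module $M\otimes_VN$ with a vertex bilinear map of type $(M,N;M\otimes_VN)$, written $(u,v)\mapsto u\otimes_zv$, such that for every $V$-module $W$ and vertex bilinear map $I_z$ of type $(M,N;W)$ there is a unique $V$-homomorphism $\varphi:M\otimes_VN\to W$ with $I_z(u,v)=\varphi(u\otimes_zv)$ ($\varphi$ extended coefficientwise). $\mathrm{Vhom}(M,N)$ is the space of linear maps $f_z:M\to N((z))$ with $f_z(du)=(d-\frac{d}{dz})f_z(u)$ for all $u$, and such that for every $a\in V$ there is $k\in\mathbb N$ with $(z-x)^ka_{\dot z}(f_x(u))=(z-x)^kf_x(a_{\dot z}u)$ for all $u\in M$. It is a $V$-module with $(df)_z=\frac{d}{dz}f_z$ and $(a_{\dot z}f)_y(u)=a_{\dot{z+y}}(f_y(u))-f_y(a_{\dot{z+y}}u-a_{\dot{y+z}}u)$. $\mathrm{Vhom}^r(M,N)$ is the space of linear maps $f_z:M\to N((z))$ with $f_z(du)=\frac{d}{dz}f_z(u)$ for all $u$, and such that for every $a\in V$ there is $k\in\mathbb N$ with $(z+x)^ka_{\dot{z+x}}(f_x(u))=(z+x)^kf_x(a_{\dot z}u)$ for all $u\in M$. It is a $V$-module with $(df)_z(u)=(d-\frac{d}{dz})(f_z(u))$ and $(a_{\dot z}f)_x(u)=a_{\dot z}(f_x(u))-f_x(a_{\dot{z-x}}u-a_{\dot{-x+z}}u)$. *)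

theory Defs
  imports
    "HOL-Computational_Algebra.Polynomial"
    "HOL-Library.FuncSet"
    "HOL-Library.Function_Algebras"
    "HOL-Library.Groups_Big_Fun"
begin

section \<open>Linear algebra on subspaces\<close>

text \<open>
  A vector space is a subspace (the carrier) of a type carrying a \<^const>\<open>vector_space\<close>
  structure; carriers are needed because spaces such as \<open>Vhom\<close> are proper subsets of a function
  type.  Maps out of a carrier are represented by total functions that are \<open>0\<close> off the
  carrier, so that two maps are equal iff they agree on the carrier, and the spaces of maps are
  subspaces of function types with the pointwise operations.
\<close>

definition linear_on ::
  "('k \<Rightarrow> 'a \<Rightarrow> 'a) \<Rightarrow> ('k \<Rightarrow> 'b \<Rightarrow> 'b) \<Rightarrow> 'a set \<Rightarrow> ('a::plus \<Rightarrow> 'b::plus) \<Rightarrow> bool" where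
  "linear_on s1 s2 A f \<longleftrightarrow>
     (\<forall>x\<in>A. \<forall>y\<in>A. f (x + y) = f x + f y) \<and> (\<forall>c. \<forall>x\<in>A. f (s1 c x) = s2 c (f x))"

definition fscale :: "('k \<Rightarrow> 'a \<Rightarrow> 'a) \<Rightarrow> 'k \<Rightarrow> ('i \<Rightarrow> 'a) \<Rightarrow> ('i \<Rightarrow> 'a)" where
  "fscale s c f = (\<lambda>x. s c (f x))"

definition linearly_isomorphic ::
  "('k::field \<Rightarrow> 'a::ab_group_add \<Rightarrow> 'a) \<Rightarrow> 'a set \<Rightarrow> ('k \<Rightarrow> 'b::ab_group_add \<Rightarrow> 'b) \<Rightarrow> 'b set \<Rightarrow> bool"
  where
  "linearly_isomorphic s1 A s2 B \<longleftrightarrow>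
     module.subspace s1 A \<and> module.subspace s2 B \<and>
     (\<exists>\<Phi>. linear_on s1 s2 A \<Phi> \<and> bij_betw \<Phi> A B)"


section \<open>Formal series\<close>

text \<open>
  A formal series in one, two or three variables is its coefficient function
  \<open>int \<Rightarrow> 'a\<close>, \<open>int \<Rightarrow> int \<Rightarrow> 'a\<close>, \<open>int \<Rightarrow> int \<Rightarrow> int \<Rightarrow> 'a\<close>:  \<open>F n\<close> is the coefficient of
  \<open>z\<^sup>n\<close>.  In particular the mode \<open>a\<^sub>n b\<close> is the value at \<open>- n - 1\<close> of the
  series of \<open>a\<close> applied to \<open>b\<close>.
  \<^const>\<open>Sum_any\<close> sums finitely supported families; in every use below the family is
  finitely supported when the series involved are Laurent series.
\<close>

definition laurent_series :: "'a set \<Rightarrow> (int \<Rightarrow> 'a::zero) set" where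
  "laurent_series S = {F. range F \<subseteq> S \<and> (\<exists>N. \<forall>n<N. F n = 0)}"

definition const_series :: "'a \<Rightarrow> int \<Rightarrow> 'a::zero" where
  "const_series a = (\<lambda>n. if n = 0 then a else 0)"

definition deriv_series :: "('k::ring_1 \<Rightarrow> 'a \<Rightarrow> 'a) \<Rightarrow> (int \<Rightarrow> 'a) \<Rightarrow> int \<Rightarrow> 'a" where
  "deriv_series s F = (\<lambda>n. s (of_int (n + 1)) (F (n + 1)))"

text \<open>\<open>exp_der s d F\<close> is \<open>e\<^sup>z\<^sup>d F(z)\<close>.\<close>

definition exp_der ::
  "('k::field_char_0 \<Rightarrow> 'a \<Rightarrow> 'a) \<Rightarrow> ('a \<Rightarrow> 'a) \<Rightarrow> (int \<Rightarrow> 'a) \<Rightarrow> int \<Rightarrow> 'a::comm_monoid_add" where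
  "exp_der s d F = (\<lambda>n. Sum_any (\<lambda>k::nat. s (inverse (fact k)) ((d ^^ k) (F (n - int k)))))"

text \<open>
  \<open>binpow \<alpha> \<beta> n i j\<close> is the coefficient of \<open>X\<^sup>i Y\<^sup>j\<close> in \<open>(\<alpha> X + \<beta> Y)\<^sup>n\<close>, expanded in
  nonnegative powers of the second summand; \<open>subst_series s \<alpha> \<beta> F\<close> is \<open>F(\<alpha> X + \<beta> Y)\<close>
  expanded in the same way.
\<close>

definition binpow :: "'k \<Rightarrow> 'k \<Rightarrow> int \<Rightarrow> int \<Rightarrow> int \<Rightarrow> 'k::field_char_0" where
  "binpow \<alpha> \<beta> n i j =
     (if i + j = n \<and> 0 \<le> j then (of_int n gchoose nat j) * (\<alpha> powi i) * (\<beta> powi j) else 0)"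

definition subst_series ::
  "('k::field_char_0 \<Rightarrow> 'a \<Rightarrow> 'a) \<Rightarrow> 'k \<Rightarrow> 'k \<Rightarrow> (int \<Rightarrow> 'a) \<Rightarrow> int \<Rightarrow> int \<Rightarrow> 'a::comm_monoid_add" where
  "subst_series s \<alpha> \<beta> F = (\<lambda>i j. Sum_any (\<lambda>n. s (binpow \<alpha> \<beta> n i j) (F n)))"

text \<open>
  \<open>delta \<alpha> \<beta> p q r\<close> is the coefficient of \<open>X\<^sup>p Y\<^sup>q Z\<^sup>r\<close> in
  \<open>\<delta>(\<alpha> X + \<beta> Y, Z) = (\<Sum>n. (\<alpha> X + \<beta> Y)\<^sup>n Z\<^sup>-\<^sup>n\<^sup>-\<^sup>1)\<close>.
\<close>

definition delta :: "'k \<Rightarrow> 'k \<Rightarrow> int \<Rightarrow> int \<Rightarrow> int \<Rightarrow> 'k::field_char_0" where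
  "delta \<alpha> \<beta> p q r = binpow \<alpha> \<beta> (- r - 1) p q"

definition mult2 ::
  "('k \<Rightarrow> 'a \<Rightarrow> 'a) \<Rightarrow> (int \<Rightarrow> int \<Rightarrow> 'k) \<Rightarrow> (int \<Rightarrow> int \<Rightarrow> 'a) \<Rightarrow> int \<Rightarrow> int \<Rightarrow> 'a::comm_monoid_add"
  where
  "mult2 s C G = (\<lambda>p q. Sum_any (\<lambda>(i, j). s (C i j) (G (p - i) (q - j))))"

definition mult3 ::
  "('k \<Rightarrow> 'a \<Rightarrow> 'a) \<Rightarrow> (int \<Rightarrow> int \<Rightarrow> int \<Rightarrow> 'k) \<Rightarrow> (int \<Rightarrow> int \<Rightarrow> int \<Rightarrow> 'a) \<Rightarrow>
    int \<Rightarrow> int \<Rightarrow> int \<Rightarrow> 'a::comm_monoid_add"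
  where
  "mult3 s C G = (\<lambda>p q r. Sum_any (\<lambda>(i, j, l). s (C i j l) (G (p - i) (q - j) (r - l))))"

text \<open>
  \<open>act_shift s Y a F\<close> is \<open>Y(a, z + x) F(x)\<close>, as a series in \<open>(z, x)\<close>.
\<close>

definition act_shift ::
  "('k::field_char_0 \<Rightarrow> 'a \<Rightarrow> 'a) \<Rightarrow> ('v \<Rightarrow> 'a \<Rightarrow> int \<Rightarrow> 'a) \<Rightarrow> 'v \<Rightarrow> (int \<Rightarrow> 'a) \<Rightarrow>
    int \<Rightarrow> int \<Rightarrow> 'a::comm_monoid_add"
  where
  "act_shift s Y a F = (\<lambda>i j. Sum_any (\<lambda>m. subst_series s 1 1 (Y a (F m)) i (j - m)))"

definition bilinear_laurent ::
  "('k \<Rightarrow> 'a \<Rightarrow> 'a) \<Rightarrow> 'a::plus set \<Rightarrow> ('k \<Rightarrow> 'b \<Rightarrow> 'b) \<Rightarrow> 'b::plus set \<Rightarrow>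
    ('k \<Rightarrow> 'c \<Rightarrow> 'c) \<Rightarrow> 'c::monoid_add set \<Rightarrow> ('a \<Rightarrow> 'b \<Rightarrow> int \<Rightarrow> 'c) \<Rightarrow> bool"
  where
  "bilinear_laurent sA A sB B sC C F \<longleftrightarrow>
     (\<forall>u\<in>A. \<forall>v\<in>B. F u v \<in> laurent_series C) \<and>
     (\<forall>v\<in>B. linear_on sA (fscale sC) A (\<lambda>u. F u v)) \<and>
     (\<forall>u\<in>A. linear_on sB (fscale sC) B (F u))"


section \<open>Vertex algebras and modules\<close>

record ('k, 'v) valg =
  vscale :: "'k \<Rightarrow> 'v \<Rightarrow> 'v"
  vop :: "'v \<Rightarrow> 'v \<Rightarrow> int \<Rightarrow> 'v"
  vone :: 'v
  vder :: "'v \<Rightarrow> 'v"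

record ('k, 'v, 'm) vmod =
  carr :: "'m set"
  scl :: "'k \<Rightarrow> 'm \<Rightarrow> 'm"
  act :: "'v \<Rightarrow> 'm \<Rightarrow> int \<Rightarrow> 'm"
  der :: "'m \<Rightarrow> 'm"

definition vertex_algebra ::
  "('k::{alg_closed_field, field_char_0}, 'v::ab_group_add) valg \<Rightarrow> bool" where
  "vertex_algebra V \<longleftrightarrow>
     (let s = vscale V; Y = vop V; d = vder V in
       vector_space s \<and>
       linear_on s s UNIV d \<and>
       bilinear_laurent s UNIV s UNIV s UNIV Y \<and>
       (\<forall>a. Y (vone V) a = const_series a) \<and>
       (\<forall>a. Y a (vone V) = exp_der s d (const_series a)) \<and>
       (\<forall>a b. Y (d a) b = deriv_series s (Y a b)) \<and>
       (\<forall>a b n. d (Y a b n) = Y (d a) b n + Y a (d b) n) \<and>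
       (\<forall>a b. Y a b = exp_der s d (\<lambda>n. s ((- 1) powi n) (Y b a n))) \<and>
       (\<forall>a b c. \<exists>l::nat.
          mult2 s (binpow 1 1 (int l)) (\<lambda>i j. Y (Y a b i) c j) =
          mult2 s (binpow 1 1 (int l)) (act_shift s Y a (Y b c))))"

definition vertex_module ::
  "('k::{alg_closed_field, field_char_0}, 'v::ab_group_add) valg \<Rightarrow>
    ('k, 'v, 'm::ab_group_add) vmod \<Rightarrow> bool" where
  "vertex_module V M \<longleftrightarrow>
     (let s = scl M; Y = act M; d = der M in
       vector_space s \<and> module.subspace s (carr M) \<and>
       d \<in> carr M \<rightarrow> carr M \<and> linear_on s s (carr M) d \<and>
       bilinear_laurent (vscale V) UNIV s (carr M) s (carr M) Y \<and>
       (\<forall>u\<in>carr M. Y (vone V) u = const_series u) \<and>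
       (\<forall>a. \<forall>u\<in>carr M. Y (vder V a) u = deriv_series s (Y a u)) \<and>
       (\<forall>a. \<forall>u\<in>carr M. \<forall>n. d (Y a u n) = Y (vder V a) u n + Y a (d u) n) \<and>
       (\<forall>a b. \<forall>u\<in>carr M. \<exists>l::nat.
          mult2 s (binpow 1 1 (int l)) (\<lambda>i j. Y (vop V a b i) u j) =
          mult2 s (binpow 1 1 (int l)) (act_shift s Y a (Y b u))))"

definition vHom ::
  "('k, 'v, 'm::ab_group_add) vmod \<Rightarrow> ('k, 'v, 'n::ab_group_add) vmod \<Rightarrow> ('m \<Rightarrow> 'n) set" where
  "vHom M N = {\<phi>.
     (\<forall>u. u \<notin> carr M \<longrightarrow> \<phi> u = 0) \<and>
     \<phi> \<in> carr M \<rightarrow> carr N \<and> linear_on (scl M) (scl N) (carr M) \<phi> \<and>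
     (\<forall>a. \<forall>u\<in>carr M. \<forall>n. \<phi> (act M a u n) = act N a (\<phi> u) n) \<and>
     (\<forall>u\<in>carr M. \<phi> (der M u) = der N (\<phi> u))}"


section \<open>Intertwining operators, vertex bilinear maps and tensor products\<close>

definition bilinear_maps ::
  "('k, 'v, 'm::ab_group_add) vmod \<Rightarrow> ('k, 'v, 'n::ab_group_add) vmod \<Rightarrow>
    ('k, 'v, 'w::ab_group_add) vmod \<Rightarrow> ('m \<Rightarrow> 'n \<Rightarrow> int \<Rightarrow> 'w) set" where
  "bilinear_maps M N W = {F.
     (\<forall>u v. u \<notin> carr M \<or> v \<notin> carr N \<longrightarrow> F u v = 0) \<and>
     bilinear_laurent (scl M) (carr M) (scl N) (carr N) (scl W) (carr W) F}"

text \<open>The series in the Jacobi identity are in the variables \<open>(x, y, z)\<close>, in this order.\<close>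

definition intertwining ::
  "('k::field_char_0, 'v, 'm::ab_group_add) vmod \<Rightarrow> ('k, 'v, 'n::ab_group_add) vmod \<Rightarrow>
    ('k, 'v, 'w::ab_group_add) vmod \<Rightarrow> ('m \<Rightarrow> 'n \<Rightarrow> int \<Rightarrow> 'w) set" where
  "intertwining M N W = {I \<in> bilinear_maps M N W.
     (\<forall>u\<in>carr M. \<forall>v\<in>carr N.
        I (der M u) v = deriv_series (scl W) (I u v) \<and>
        (\<forall>n. der W (I u v n) = I (der M u) v n + I u (der N v) n)) \<and>
     (\<forall>a. \<forall>u\<in>carr M. \<forall>v\<in>carr N.
        mult3 (scl W) (\<lambda>p q r. delta 1 (- 1) p q r)
          (\<lambda>p q r. const_series (act W a (I u v q) p) r)
      - mult3 (scl W) (\<lambda>p q r. delta (- 1) 1 q p r)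
          (\<lambda>p q r. const_series (I u (act N a v p) q) r)
      = mult3 (scl W) (\<lambda>p q r. delta 1 (- 1) p r q)
          (\<lambda>p q r. const_series (I (act M a u r) v q) p))}"

definition vertex_bilinear ::
  "('k::field_char_0, 'v, 'm::ab_group_add) vmod \<Rightarrow> ('k, 'v, 'n::ab_group_add) vmod \<Rightarrow>
    ('k, 'v, 'w::ab_group_add) vmod \<Rightarrow> ('m \<Rightarrow> 'n \<Rightarrow> int \<Rightarrow> 'w) set" where
  "vertex_bilinear M N W = {F \<in> bilinear_maps M N W.
     (\<forall>u\<in>carr M. \<forall>v\<in>carr N.
        F (der M u) v = deriv_series (scl W) (F u v) \<and>
        F u (der N v) = (\<lambda>n. der W (F u v n)) - deriv_series (scl W) (F u v)) \<and>
     (\<forall>a. \<forall>u\<in>carr M. \<forall>v\<in>carr N. \<exists>n k :: nat.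
        mult2 (scl W) (binpow 1 1 (int n)) (act_shift (scl W) (act W) a (F u v)) =
        mult2 (scl W) (binpow 1 1 (int n)) (\<lambda>i j. F (act M a u i) v j) \<and>
        mult2 (scl W) (binpow 1 (- 1) (int k)) (\<lambda>i j. act W a (F u v j) i) =
        mult2 (scl W) (binpow 1 (- 1) (int k)) (\<lambda>i j. F u (act N a v i) j))}"

text \<open>
  The universal property ranges over all \<open>V\<close>-modules whose underlying additive group
  is a subgroup of the type \<open>'w\<close>, which is a parameter since a formula cannot quantify over
  types.  A tensor product satisfies this condition for every \<open>'w\<close>.
\<close>

definition is_tensor_product ::
  "'w::ab_group_add itself \<Rightarrow> ('k::{alg_closed_field, field_char_0}, 'v::ab_group_add) valg \<Rightarrow>
    ('k, 'v, 'm::ab_group_add) vmod \<Rightarrow> ('k, 'v, 'n::ab_group_add) vmod \<Rightarrow>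
    ('k, 'v, 't::ab_group_add) vmod \<Rightarrow> ('m \<Rightarrow> 'n \<Rightarrow> int \<Rightarrow> 't) \<Rightarrow> bool" where
  "is_tensor_product (_ :: 'w::ab_group_add itself) V M N T tens \<longleftrightarrow>
     vertex_module V T \<and> tens \<in> vertex_bilinear M N T \<and>
     (\<forall>W :: ('k, 'v, 'w) vmod. vertex_module V W \<longrightarrow>
        (\<forall>I \<in> vertex_bilinear M N W.
           \<exists>!\<phi>. \<phi> \<in> vHom T W \<and>
             (\<forall>u\<in>carr M. \<forall>v\<in>carr N. \<forall>n. I u v n = \<phi> (tens u v n))))"


section \<open>The modules \<open>Vhom\<close> and \<open>Vhom\<^sup>r\<close>\<close>

definition linear_laurent_maps ::
  "('k, 'v, 'm::ab_group_add) vmod \<Rightarrow> ('k, 'v, 'n::ab_group_add) vmod \<Rightarrow>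
    ('m \<Rightarrow> int \<Rightarrow> 'n) set" where
  "linear_laurent_maps M N = {f.
     (\<forall>u. u \<notin> carr M \<longrightarrow> f u = 0) \<and>
     f \<in> carr M \<rightarrow> laurent_series (carr N) \<and>
     linear_on (scl M) (fscale (scl N)) (carr M) f}"

text \<open>
  In both actions \<open>D i l\<close> is the coefficient of \<open>z\<^sup>i y\<^sup>l\<close> (resp. \<open>z\<^sup>i x\<^sup>l\<close>)
  in the difference of two expansions to which \<open>f\<close> is applied; for fixed \<open>i\<close>, only
  finitely many of these are nonzero.
\<close>

definition Vhom ::
  "('k::field_char_0, 'v, 'm::ab_group_add) vmod \<Rightarrow> ('k, 'v, 'n::ab_group_add) vmod \<Rightarrow>
    ('k, 'v, 'm \<Rightarrow> int \<Rightarrow> 'n) vmod" where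
  "Vhom M N = \<lparr>
     carr = {f \<in> linear_laurent_maps M N.
       (\<forall>u\<in>carr M. f (der M u) = (\<lambda>n. der N (f u n)) - deriv_series (scl N) (f u)) \<and>
       (\<forall>a. \<exists>k::nat. \<forall>u\<in>carr M.
          mult2 (scl N) (binpow 1 (- 1) (int k)) (\<lambda>i j. act N a (f u j) i) =
          mult2 (scl N) (binpow 1 (- 1) (int k)) (\<lambda>i j. f (act M a u i) j))},
     scl = fscale (fscale (scl N)),
     act = (\<lambda>a f i u j.
       if u \<in> carr M then
         let D = (\<lambda>i l. subst_series (scl M) 1 1 (act M a u) i l
                      - subst_series (scl M) 1 1 (act M a u) l i)
         in act_shift (scl N) (act N) a (f u) i j - Sum_any (\<lambda>l. f (D i l) (j - l))
       else 0),
     der = (\<lambda>f u. if u \<in> carr M then deriv_series (scl N) (f u) else 0)\<rparr>"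

definition Vhom_r ::
  "('k::field_char_0, 'v, 'm::ab_group_add) vmod \<Rightarrow> ('k, 'v, 'n::ab_group_add) vmod \<Rightarrow>
    ('k, 'v, 'm \<Rightarrow> int \<Rightarrow> 'n) vmod" where
  "Vhom_r M N = \<lparr>
     carr = {f \<in> linear_laurent_maps M N.
       (\<forall>u\<in>carr M. f (der M u) = deriv_series (scl N) (f u)) \<and>
       (\<forall>a. \<exists>k::nat. \<forall>u\<in>carr M.
          mult2 (scl N) (binpow 1 1 (int k)) (act_shift (scl N) (act N) a (f u)) =
          mult2 (scl N) (binpow 1 1 (int k)) (\<lambda>i j. f (act M a u i) j))},
     scl = fscale (fscale (scl N)),
     act = (\<lambda>a f i u j.
       if u \<in> carr M then
         let D = (\<lambda>i l. subst_series (scl M) 1 (- 1) (act M a u) i l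
                      - subst_series (scl M) (- 1) 1 (act M a u) l i)
         in act N a (f u j) i - Sum_any (\<lambda>l. f (D i l) (j - l))
       else 0),
     der = (\<lambda>f u. if u \<in> carr M then (\<lambda>n. der N (f u n)) - deriv_series (scl N) (f u) else 0)\<rparr>"

end

theory Submission
  imports Defs
begin

text \<open>
  For fixed \<open>a\<close>, \<open>u\<close>, \<open>v\<close> let \<open>J(x, y, z)\<close> be the difference of the two sides of the Jacobi
  identity.  Each of the three delta series is annihilated by \<open>x - y - z\<close>, hence so is \<open>J\<close>, and
  this recurrence forces \<open>J = 0\<close> as soon as all coefficients of \<open>J\<close> vanish for one exponent
  of \<open>x\<close> and for one exponent of \<open>z\<close>.
  In the coefficient of \<open>z\<^sup>-\<^sup>1\<^sup>-\<^sup>k\<close> the right-hand side is zero for large \<open>k\<close>, and the other two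
  terms agree iff weak commutativity of order \<open>k\<close> holds; likewise the coefficient of
  \<open>x\<^sup>-\<^sup>1\<^sup>-\<^sup>n\<close> for large \<open>n\<close> is weak associativity of order \<open>n\<close>.  The formula for the action
  on \<open>Vhom\<close> is the coefficient of \<open>x\<^sup>-\<^sup>1\<close>, the one for \<open>Vhom\<^sup>r\<close> that of \<open>z\<^sup>-\<^sup>1\<close>.
  So, up to currying, all spaces except \<open>Hom(M \<otimes> N, W)\<close> are literally the same set of maps,
  and the latter is identified with it by the universal property.
\<close>

section \<open>Linear maps on subspaces\<close>

lemma linear_on_0:
  fixes f :: "'a::monoid_add \<Rightarrow> 'b::cancel_comm_monoid_add"
  assumes "linear_on s1 s2 A f" "0 \<in> A"
  shows "f 0 = 0"
  using assms unfolding linear_on_def by (metis add.right_neutral add_cancel_right_right)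

lemma linear_on_add: "linear_on s1 s2 A f \<Longrightarrow> x \<in> A \<Longrightarrow> y \<in> A \<Longrightarrow> f (x + y) = f x + f y"
  by (simp add: linear_on_def)

lemma linear_on_scale: "linear_on s1 s2 A f \<Longrightarrow> x \<in> A \<Longrightarrow> f (s1 c x) = s2 c (f x)"
  by (simp add: linear_on_def)

lemma vector_space_fscale:
  assumes "vector_space s" shows "vector_space (fscale s)"
proof -
  interpret vector_space s by fact
  show ?thesis
    by unfold_locales (auto simp: fscale_def fun_eq_iff scale_right_distrib scale_left_distrib)
qed

lemma subspace_iff:
  assumes "vector_space s"
  shows "module.subspace s S \<longleftrightarrow>
    0 \<in> S \<and> (\<forall>x\<in>S. \<forall>y\<in>S. x + y \<in> S) \<and> (\<forall>c. \<forall>x\<in>S. s c x \<in> S)"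
proof -
  interpret vector_space s by fact
  show ?thesis by (simp add: subspace_def)
qed

text \<open>An image of a subspace is a subspace, so closure has to be checked by hand only for
  \<open>intertwining M N W\<close> and \<open>vHom T W\<close>; the other spaces arise as their
  images.\<close>

lemma linearly_isomorphic_image:
  assumes s1: "vector_space s1" and s2: "vector_space s2" and A: "module.subspace s1 A"
    and h: "linear_on s1 s2 A h" and inj: "inj_on h A"
  shows "linearly_isomorphic s1 A s2 (h ` A)"
  unfolding linearly_isomorphic_def
proof (intro conjI exI)
  note A = A[unfolded subspace_iff[OF s1]]
  have "0 \<in> h ` A" using linear_on_0[OF h] A by (metis image_eqI)
  moreover have "h x + h y \<in> h ` A" if "x \<in> A" "y \<in> A" for x y
    using that A linear_on_add[OF h that, symmetric] by simp
  moreover have "s2 c (h x) \<in> h ` A" if "x \<in> A" for c x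
    using that A linear_on_scale[OF h that, of c, symmetric] by simp
  ultimately show "module.subspace s2 (h ` A)"
    unfolding subspace_iff[OF s2] by blast
qed (use assms in \<open>auto simp: bij_betw_def\<close>)

lemma linearly_isomorphic_sym:
  assumes s1: "vector_space s1" and iso: "linearly_isomorphic s1 A s2 B"
  shows "linearly_isomorphic s2 B s1 A"
proof -
  obtain h where h: "linear_on s1 s2 A h" "bij_betw h A B"
    using iso by (auto simp: linearly_isomorphic_def)
  define g where "g = inv_into A h"
  have g: "g y \<in> A" "h (g y) = y" if "y \<in> B" for y
    using that h(2) unfolding g_def by (auto simp: bij_betw_def inv_into_into f_inv_into_f)
  have gh: "g (h x) = x" if "x \<in> A" for x
    using that h(2) unfolding g_def by (auto simp: bij_betw_def)
  have A: "\<And>x y. x \<in> A \<Longrightarrow> y \<in> A \<Longrightarrow> x + y \<in> A" "\<And>c x. x \<in> A \<Longrightarrow> s1 c x \<in> A"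
    using iso by (auto simp: linearly_isomorphic_def subspace_iff[OF s1])
  have "g (x + y) = g x + g y" if "x \<in> B" "y \<in> B" for x y
    using gh[OF A(1)[OF g(1)[OF that(1)] g(1)[OF that(2)]]] g that by (simp add: linear_on_add[OF h(1)])
  moreover have "g (s2 c x) = s1 c (g x)" if "x \<in> B" for c x
    using gh[OF A(2)[OF g(1)[OF that]], of c] g that by (simp add: linear_on_scale[OF h(1)])
  ultimately have "linear_on s2 s1 B g" by (simp add: linear_on_def)
  moreover have "bij_betw g B A" unfolding g_def by (rule bij_betw_inv_into[OF h(2)])
  ultimately show ?thesis using iso by (auto simp: linearly_isomorphic_def)
qed

section \<open>Sums and binomial coefficients\<close>

text \<open>The supports correspond under \<open>h\<close>, so both sums are finite together or both
  take the default value 0.\<close>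

lemma Sum_any_reindex_inj:
  assumes "inj h" and "\<And>x. f x \<noteq> 0 \<Longrightarrow> x \<in> range h"
  shows "Sum_any f = Sum_any (\<lambda>m. f (h m))"
proof -
  have *: "{x. f x \<noteq> 0} = h ` {m. f (h m) \<noteq> 0}"
    using assms(2) by auto
  have inj: "inj_on h A" for A using assms(1) by (auto intro: inj_on_subset)
  show ?thesis
    unfolding Sum_any.expand_set * finite_image_iff[OF inj] by (simp add: sum.reindex[OF inj])
qed

lemma Sum_any_shift: "Sum_any f = Sum_any (\<lambda>l. f (r + l))" for r :: "'b::group_add"
  by (rule Sum_any_reindex_inj) simp_all

text \<open>Homomorphisms are additive on a carrier \<open>S\<close>, so the induction also keeps
  the partial sums inside \<open>S\<close>.\<close>

lemma Sum_any_hom: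
  assumes fin: "finite {x. f x \<noteq> 0}"
    and mem: "\<And>x. f x \<in> S" and zero: "0 \<in> S"
    and plus: "\<And>x y. x \<in> S \<Longrightarrow> y \<in> S \<Longrightarrow> x + y \<in> S"
    and hom: "\<And>x y. x \<in> S \<Longrightarrow> y \<in> S \<Longrightarrow> h (x + y) = h x + (h y :: 'b::cancel_comm_monoid_add)"
  shows "h (Sum_any f) = Sum_any (\<lambda>x. h (f x))"
proof -
  have h0: "h 0 = 0" using hom[OF zero zero] by simp
  have "h (sum f B) = (\<Sum>x\<in>B. h (f x)) \<and> sum f B \<in> S" if "finite B" for B
    using that by induction (auto simp: h0 zero mem plus hom)
  moreover have "Sum_any f = sum f {x. f x \<noteq> 0}" by (simp add: Sum_any.expand_set fin)
  moreover have "Sum_any (\<lambda>x. h (f x)) = (\<Sum>x\<in>{x. f x \<noteq> 0}. h (f x))"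
    using h0 by (intro Sum_any.expand_superset fin) auto
  ultimately show ?thesis using fin by simp
qed

text \<open>Pascal's rule: (\<alpha> X + \<beta> Y)^n is multiplied by one more factor, for any
  integer n.\<close>

lemma binpow_Suc:
  assumes "\<alpha> \<noteq> 0" "\<beta> \<noteq> 0"
  shows "binpow \<alpha> \<beta> (n + 1) i j = \<alpha> * binpow \<alpha> \<beta> n (i - 1) j + \<beta> * binpow \<alpha> \<beta> n i (j - 1)"
proof (cases "i + j = n + 1 \<and> 0 \<le> j")
  case True
  have powi: "\<alpha> powi i = \<alpha> * \<alpha> powi (i - 1)" "\<beta> powi j = \<beta> * \<beta> powi (j - 1)"
    using assms power_int_add_1'[of \<alpha> "i - 1"] power_int_add_1'[of \<beta> "j - 1"] by auto
  show ?thesis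
  \<comment> \<open>At \<open>j = 0\<close> the second summand asks for a negative power of Y, which
    is 0 by definition.\<close>
  proof (cases "j = 0")
    case True
    then show ?thesis using \<open>i + j = n + 1 \<and> 0 \<le> j\<close> powi by (simp add: binpow_def)
  next
    case False
    define t where "t = nat (j - 1)"
    have t: "nat j = Suc t" "nat (j - 1) = t" and j: "1 \<le> j"
      using False True unfolding t_def by linarith+
    have "(of_int (n + 1) gchoose Suc t :: 'a) = (of_int n gchoose t) + (of_int n gchoose Suc t)"
      by (simp add: gbinomial_Suc_Suc)
    then show ?thesis using True j unfolding binpow_def powi t
      by (simp add: t algebra_simps del: of_int_add)
  qed
qed (auto simp: binpow_def)

text \<open>Separates the binomial coefficient in \<open>binpow\<close> from the powers of \<alpha>
  and \<beta>. The integer lower index keeps reflections such as \<open>n - j\<close> free of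
  truncation.\<close>

definition ebinom :: "int \<Rightarrow> int \<Rightarrow> 'k::field_char_0" where
  "ebinom n j = (if 0 \<le> j then of_int n gchoose nat j else 0)"

lemma binpow_ebinom: "binpow \<alpha> \<beta> n i j = (if i + j = n then ebinom n j * \<alpha> powi i * \<beta> powi j else 0)"
  by (simp add: binpow_def ebinom_def)

lemma ebinom_symmetric: "n \<ge> 0 \<Longrightarrow> ebinom n j = ebinom n (n - j)"
proof -
  assume "n \<ge> 0"
  then obtain N where N: "n = int N" by (metis nat_0_le)
  consider "j < 0" | "int N < j" | t where "j = int t" "t \<le> N"
    using nat_0_le[of j] by (metis linorder_not_less of_nat_le_iff)
  then show ?thesis
  proof cases
    case 3
    then show ?thesis using binomial_symmetric[of t N]
      by (simp add: ebinom_def N binomial_gbinomial[symmetric] nat_diff_distrib)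
  qed (auto simp: ebinom_def N binomial_gbinomial[symmetric] binomial_eq_0 zless_nat_eq_int_zless)
qed

lemma ebinom_negate: "ebinom n j = (- 1) powi j * ebinom (j - n - 1) j"
proof (cases "0 \<le> j")
  case True
  then obtain t where "j = int t" by (metis nat_0_le)
  then show ?thesis
    using gbinomial_negated_upper[of "of_int n :: 'a" t] by (simp add: ebinom_def)
qed (simp add: ebinom_def)

text \<open>In disguise, this is \<open>\<delta>(x - y, z) - \<delta>(- y + x, z) = \<delta>(x - z, y)\<close>.\<close>

lemma ebinom_diff:
  "ebinom n j - ebinom n (n - j) = ((- 1) powi j * ebinom (j - n - 1) (- 1 - n) :: 'a::field_char_0)"
proof (cases "n \<ge> 0")
  case True
  then show ?thesis using ebinom_symmetric[of n j, where 'a='a] by (simp add: ebinom_def)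
next
  case n: False
  show ?thesis
  \<comment> \<open>For \<open>n < 0\<close> the left-hand terms have the disjoint supports
    \<open>j \<ge> 0\<close> and \<open>j \<le> n\<close>. If \<open>j > n\<close>, only the first
    can survive, and negating its upper index and then reflecting the lower one gives the right-hand
    side.\<close>
  proof (cases "0 \<le> j - n - 1")
    case True
    then have "ebinom n (n - j) = (0 :: 'a)" by (simp add: ebinom_def)
    then show ?thesis
      using ebinom_negate[of n j, where 'a='a] ebinom_symmetric[OF True, of j, where 'a='a]
      by (simp add: minus_diff_commute)
  next
    case False
    then have "ebinom n j = (0 :: 'a)" using n by (simp add: ebinom_def)
    \<comment> \<open>Here \<open>j \<le> n < 0\<close>. Negation sends both remaining terms to the
      upper index \<open>- j - 1\<close>, with lower indices \<open>n - j\<close> and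
      \<open>- 1 - n\<close>, which add up to it.\<close>
    moreover have "ebinom n (n - j) = (- 1) powi (n - j) * (ebinom (- j - 1) (n - j) :: 'a)"
      using ebinom_negate[of n "n - j", where 'a='a] by simp
    moreover have "ebinom (- j - 1) (n - j) = (ebinom (- j - 1) (- 1 - n) :: 'a)"
      using ebinom_symmetric[of "- j - 1" "n - j", where 'a='a] False n by simp
    moreover have "ebinom (j - n - 1) (- 1 - n) = (- 1) powi (- 1 - n) * (ebinom (- j - 1) (- 1 - n) :: 'a)"
      using ebinom_negate[of "j - n - 1" "- 1 - n", where 'a='a] by simp
    moreover have "(- 1 :: 'a) powi (n - j) = - ((- 1) powi j * (- 1) powi (- 1 - n))"
      by (simp add: power_int_minus_left)
    ultimately show ?thesis by (simp add: algebra_simps)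
  qed
qed

section \<open>Expansions of delta series\<close>

text \<open>The coefficients of a series annihilated by \<open>x - y - z\<close>.\<close>

definition kernel_recurrence :: "(int \<Rightarrow> int \<Rightarrow> int \<Rightarrow> 'a::plus) \<Rightarrow> bool" where
  "kernel_recurrence X \<longleftrightarrow> (\<forall>p q r. X (p - 1) q r = X p (q - 1) r + X p q (r - 1))"

lemma kernel_recurrenceD:
  "kernel_recurrence X \<Longrightarrow> X (p - 1) q r = X p (q - 1) r + X p q (r - 1)"
  by (simp add: kernel_recurrence_def)

lemma kernel_recurrence_diff:
  fixes X Y :: "int \<Rightarrow> int \<Rightarrow> int \<Rightarrow> 'a::ab_group_add"
  shows "kernel_recurrence X \<Longrightarrow> kernel_recurrence Y \<Longrightarrow>
    kernel_recurrence (\<lambda>p q r. X p q r - Y p q r)"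
  by (simp add: kernel_recurrence_def)

text \<open>The plane \<open>p\<close> determines the plane \<open>p - 1\<close>, so zeros propagate
  downwards.\<close>

lemma kernel_recurrence_zero_x:
  fixes X :: "int \<Rightarrow> int \<Rightarrow> int \<Rightarrow> 'a::monoid_add"
  assumes X: "kernel_recurrence X" and zero: "\<And>q r. X P q r = 0" and "p \<le> P"
  shows "X p q r = 0"
  using \<open>p \<le> P\<close>
proof (induction p arbitrary: q r rule: int_le_induct)
  case (step i)
  then show ?case using kernel_recurrenceD[OF X, of i] by simp
qed (rule zero)

text \<open>Solved for \<open>X p q (r - 1)\<close>, the recurrence determines the plane
  \<open>r - 1\<close> from the plane \<open>r\<close>.\<close>

lemma kernel_recurrence_zero_z:
  fixes X :: "int \<Rightarrow> int \<Rightarrow> int \<Rightarrow> 'a::ab_group_add"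
  assumes X: "kernel_recurrence X" and zero: "\<And>p q. X p q R = 0" and "r \<le> R"
  shows "X p q r = 0"
  using \<open>r \<le> R\<close>
proof (induction r arbitrary: p q rule: int_le_induct)
  case (step i)
  then show ?case using kernel_recurrenceD[OF X, of _ _ i] by simp
qed (rule zero)

text \<open>Below \<open>P\<close> and below \<open>R\<close> zeros propagate downwards. In the
  remaining quadrant the recurrence is used as
  \<open>X p q r = X (p - 1) (q + 1) r - X p (q + 1) (r - 1)\<close> in an upward double induction,
  on \<open>p\<close> outside and on \<open>r\<close> inside.\<close>

lemma kernel_recurrence_zero:
  fixes X :: "int \<Rightarrow> int \<Rightarrow> int \<Rightarrow> 'a::ab_group_add"
  assumes X: "kernel_recurrence X" and P: "\<And>q r. X P q r = 0" and R: "\<And>p q. X p q R = 0"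
  shows "X p q r = 0"
proof (cases "p \<le> P")
  case True
  then show ?thesis by (rule kernel_recurrence_zero_x[OF X P])
next
  case False
  then have "P \<le> p" by simp
  then show ?thesis
  proof (induction p arbitrary: q r rule: int_ge_induct)
    case (step i)
    show ?case
    proof (cases "r \<le> R")
      case True
      then show ?thesis by (rule kernel_recurrence_zero_z[OF X R])
    next
      case False
      then have "R \<le> r" by simp
      then show ?thesis
      proof (induction r arbitrary: q rule: int_ge_induct)
        case (step j)
        then show ?case
          using kernel_recurrenceD[OF X, of "i + 1" "q + 1" "j + 1"] \<open>\<And>q r. X i q r = 0\<close> by simp
      qed (rule R)
    qed
  qed (rule P)
qed

text \<open>
  In the product of \<open>\<delta>(x - y, z)\<close> with \<open>G(x, y)\<close> the exponents of a factor of \<open>G\<close> contributing to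
  \<open>x\<^sup>p y\<^sup>q z\<^sup>r\<close> add up to \<open>p + q + r + 1\<close>; \<open>kernel_x m p q r\<close> is the coefficient with which
  the term of \<open>G\<close> of exponent \<open>m\<close> in \<open>y\<close> enters.  The other kernels belong to
  \<open>\<delta>(- y + x, z)\<close> and \<open>\<delta>(x - z, y)\<close>, with \<open>m\<close> the exponent of \<open>x\<close> resp. \<open>z\<close>.
\<close>

definition kernel_x :: "int \<Rightarrow> int \<Rightarrow> int \<Rightarrow> int \<Rightarrow> 'k::field_char_0" where
  "kernel_x m p q r = binpow 1 (- 1) (- r - 1) (m - q - r - 1) (q - m)"

definition kernel_y :: "int \<Rightarrow> int \<Rightarrow> int \<Rightarrow> int \<Rightarrow> 'k::field_char_0" where
  "kernel_y m p q r = binpow (- 1) 1 (- r - 1) (m - p - r - 1) (p - m)"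

definition kernel_z :: "int \<Rightarrow> int \<Rightarrow> int \<Rightarrow> int \<Rightarrow> 'k::field_char_0" where
  "kernel_z m p q r = binpow 1 (- 1) (p + r - m) p (r - m)"

text \<open>The bound on \<open>m\<close> makes products with lower bounded series finite sums. The
  three kernels vanish unless \<open>m \<le> q\<close>, \<open>m \<le> p\<close> and
  \<open>m \<le> r\<close> respectively; the maximum is a common bound.\<close>

definition jacobi_kernel :: "(int \<Rightarrow> int \<Rightarrow> int \<Rightarrow> int \<Rightarrow> 'k::field_char_0) \<Rightarrow> bool" where
  "jacobi_kernel c \<longleftrightarrow> (\<forall>m. kernel_recurrence (c m)) \<and>
     (\<forall>m p q r. max p (max q r) < m \<longrightarrow> c m p q r = 0)"

text \<open>Multiplication by x - y acts on \<delta>(x - y, z) as multiplication by z;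
  coefficientwise this is Pascal's rule. For \<delta>(x - z, y) it is x - z that acts as y.\<close>

lemma jacobi_kernel_x: "jacobi_kernel kernel_x"
proof -
  have "kernel_x m (p - 1) q r = kernel_x m p (q - 1) r + (kernel_x m p q (r - 1) :: 'a)" for m p q r
    using binpow_Suc[of "1 :: 'a" "- 1" "- r - 1" "m - q - r" "q - m"]
    by (simp add: kernel_x_def algebra_simps)
  then show ?thesis by (auto simp: jacobi_kernel_def kernel_recurrence_def kernel_x_def binpow_def)
qed

lemma jacobi_kernel_y: "jacobi_kernel kernel_y"
proof -
  have "kernel_y m (p - 1) q r = kernel_y m p (q - 1) r + (kernel_y m p q (r - 1) :: 'a)" for m p q r
    using binpow_Suc[of "- 1 :: 'a" 1 "- r - 1" "m - p - r" "p - m"]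
    by (simp add: kernel_y_def algebra_simps)
  then show ?thesis by (auto simp: jacobi_kernel_def kernel_recurrence_def kernel_y_def binpow_def)
qed

lemma jacobi_kernel_z: "jacobi_kernel kernel_z"
proof -
  have "kernel_z m (p - 1) q r = kernel_z m p (q - 1) r + (kernel_z m p q (r - 1) :: 'a)" for m p q r
    using binpow_Suc[of "1 :: 'a" "- 1" "p + r - m - 1" p "r - m"]
    by (simp add: kernel_z_def algebra_simps)
  then show ?thesis by (auto simp: jacobi_kernel_def kernel_recurrence_def kernel_z_def binpow_def)
qed

text \<open>The residue in x of \<delta>(x - y, z) times a power of x is the same power of z + y.
  Negating the upper index removes the signs.\<close>

lemma kernel_x_minus_1_x:
  "kernel_x m (- 1) q r = (binpow 1 1 (q + r - m) r (q - m) :: 'k::field_char_0)"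
  using ebinom_negate[of "- r - 1" "q - m", where 'a='k]
  by (simp add: kernel_x_def binpow_ebinom power_int_mult_distrib[symmetric] algebra_simps)

text \<open>The residue in x of \<delta>(- y + x, z) x^m is (z + y)^m - (y + z)^m, the difference of
  expansions in the action on \<open>Vhom\<close>.\<close>

lemma kernel_y_minus_1_x:
  "kernel_y m (- 1) q r = (binpow 1 1 m r (m - r) - binpow 1 1 m (m - r) r :: 'k::field_char_0)"
  using ebinom_diff[of m "m - r", where 'a='k]
  by (simp add: kernel_y_def binpow_ebinom algebra_simps)

text \<open>The residue in z of \<delta>(x - z, y) z^m is (x - y)^m - (- y + x)^m, the difference of
  expansions in the action on \<open>Vhom_r\<close>.\<close>

lemma kernel_z_minus_1_z:
  "kernel_z m p q (- 1) =
    (binpow 1 (- 1) m p (m - p) - binpow (- 1) 1 m (m - p) p :: 'k::field_char_0)"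
proof -
  have "(- 1 :: 'k) powi (- 1 - m) = - ((- 1) powi m)" "(- 1 :: 'k) powi (m - p) = (- 1) powi m * (- 1) powi p"
    by (simp_all add: power_int_minus_left)
  then show ?thesis
    using ebinom_diff[of m p, where 'a='k]
    by (simp add: kernel_z_def binpow_ebinom power_int_minus_left algebra_simps)
qed

text \<open>The value type is arbitrary: for a family of series the bound concerns the first index,
  and \<open>G m = 0\<close> means the zero series.\<close>

definition lower_bounded :: "(int \<Rightarrow> 'b::zero) \<Rightarrow> bool" where
  "lower_bounded G \<longleftrightarrow> (\<exists>N. \<forall>m<N. G m = 0)"

lemma kernel_y_eq_0: "p < m \<Longrightarrow> kernel_y m p q r = 0"
  by (simp add: kernel_y_def binpow_def)

lemma kernel_z_eq_0: "r < m \<Longrightarrow> kernel_z m p q r = 0"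
  by (simp add: kernel_z_def binpow_def)

lemma kernel_x_minus_1_z: "kernel_x m p q (- 1) = (if m = q then 1 else 0)"
  by (auto simp: kernel_x_def binpow_ebinom ebinom_def nat_diff_distrib gbinomial_0_left)

lemma kernel_y_minus_1_z: "kernel_y m p q (- 1) = (if m = p then 1 else 0)"
  by (auto simp: kernel_y_def binpow_ebinom ebinom_def gbinomial_0_left)

text \<open>Here x - z has exponent \<open>r - m - 1\<close>. For \<open>m < r\<close> this is
  nonnegative and x^-1 does not occur, for \<open>m > r\<close> the power of z would be negative,
  and for \<open>m = r\<close> the exponent is -1.\<close>

lemma kernel_z_minus_1_x: "kernel_z m (- 1) q r = (if m = r then 1 else 0)"
  using ebinom_symmetric[of "r - m - 1" "r - m", where 'a='a]
  by (auto simp: kernel_z_def binpow_ebinom ebinom_def algebra_simps)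

lemma subst_series_eq:
  fixes s :: "'k::field_char_0 \<Rightarrow> 'a::ab_group_add \<Rightarrow> 'a"
  assumes "vector_space s"
  shows "subst_series s \<alpha> \<beta> F i j = s (binpow \<alpha> \<beta> (i + j) i j) (F (i + j))"
proof -
  interpret vector_space s by fact
  have "(\<lambda>n. s (binpow \<alpha> \<beta> n i j) (F n)) =
      (\<lambda>n. if n = i + j then s (binpow \<alpha> \<beta> (i + j) i j) (F (i + j)) else 0)"
    by (auto simp: binpow_def)
  then show ?thesis by (simp only: subst_series_def Sum_any.delta)
qed

section \<open>Products of delta series with doubly indexed families\<close>

locale formal_space = vector_space scale
  for scale :: "'k::field_char_0 \<Rightarrow> 'a::ab_group_add \<Rightarrow> 'a"
begin

text \<open>Homogeneity of (x + \<beta> y)^n leaves one summation index, the second exponent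
  \<open>m\<close> in the factor \<open>G\<close>.\<close>

lemma mult2_binpow:
  "mult2 scale (binpow 1 \<beta> n) G p q =
    Sum_any (\<lambda>m. scale (binpow 1 \<beta> n (n - q + m) (q - m)) (G (p + q - n - m) m))"
proof -
  have "mult2 scale (binpow 1 \<beta> n) G p q =
      Sum_any (\<lambda>m. case (n - q + m, q - m) of (i, j) \<Rightarrow> scale (binpow 1 \<beta> n i j) (G (p - i) (q - j)))"
    unfolding mult2_def
  proof (rule Sum_any_reindex_inj)
    show "inj (\<lambda>m. (n - q + m, q - m))" by (auto intro: injI)
    fix x :: "int \<times> int"
    assume "(case x of (i, j) \<Rightarrow> scale (binpow 1 \<beta> n i j) (G (p - i) (q - j))) \<noteq> 0"
    then have "x = (n - q + (q - snd x), q - (q - snd x))"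
      by (auto simp: binpow_def split: prod.splits if_splits)
    then show "x \<in> range (\<lambda>m. (n - q + m, q - m))" by blast
  qed
  then show ?thesis by (simp add: algebra_simps)
qed

lemma mult2_binpow_0: "mult2 scale (binpow 1 \<beta> 0) G p q = G p q"
proof -
  have "(\<lambda>m. scale (binpow 1 \<beta> 0 (0 - q + m) (q - m)) (G (p + q - 0 - m) m)) =
      (\<lambda>m. if m = q then G p q else 0)"
    by (auto simp: binpow_ebinom ebinom_def gbinomial_0_left)
  then show ?thesis by (simp only: mult2_binpow Sum_any.delta)
qed

text \<open>The sum splits by Pascal's rule; both parts are finite because a power with natural
  exponent \<open>n\<close> has y-degrees in \<open>{0..int n}\<close> only.\<close>

lemma mult2_binpow_Suc:
  assumes "\<beta> \<noteq> 0"
  shows "mult2 scale (binpow 1 \<beta> (int (Suc n))) G p q =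
    mult2 scale (binpow 1 \<beta> (int n)) G (p - 1) q + scale \<beta> (mult2 scale (binpow 1 \<beta> (int n)) G p (q - 1))"
proof -
  let ?f = "\<lambda>m. scale (binpow 1 \<beta> (int n) (int n - q + m) (q - m)) (G (p - 1 + q - int n - m) m)"
  let ?g = "\<lambda>m. scale (binpow 1 \<beta> (int n) (int n - (q - 1) + m) (q - 1 - m)) (G (p + (q - 1) - int n - m) m)"
  have small: "binpow 1 \<beta> (int n) i j = 0" if "j \<notin> {0..int n}" for i j
  proof (cases "j < 0")
    case False
    then show ?thesis using that
      by (auto simp: binpow_def binomial_gbinomial[symmetric] intro!: binomial_eq_0)
  qed (simp add: binpow_def)
  have "{m. ?f m \<noteq> 0} \<subseteq> {q - int n..q}" "{m. ?g m \<noteq> 0} \<subseteq> {q - 1 - int n..q - 1}"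
    using small by (auto, (smt (verit) scale_zero_left)+)
  then have f: "finite {m. ?f m \<noteq> 0}" and g: "finite {m. ?g m \<noteq> 0}"
    by (auto intro: finite_subset)
  have g': "finite {m. scale \<beta> (?g m) \<noteq> 0}" by (rule finite_subset[OF _ g]) auto
  have "Sum_any (\<lambda>m. scale \<beta> (?g m)) = scale \<beta> (Sum_any ?g)"
    by (rule Sum_any_hom[OF g, of UNIV, symmetric]) (auto simp: scale_right_distrib)
  moreover have "scale (binpow 1 \<beta> (int n + 1) (int n + 1 - q + m) (q - m)) (G (p + q - (int n + 1) - m) m)
      = ?f m + scale \<beta> (?g m)" for m
    using assms binpow_Suc[of 1 \<beta> "int n" "int n + 1 - q + m" "q - m"]
    by (simp add: algebra_simps)
  ultimately show ?thesis
    unfolding mult2_binpow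
    by (simp only: of_nat_Suc add.commute[of 1] Sum_any.distrib[OF f g'])
qed

text \<open>Lowering the exponent of x by one multiplies a plane by z + y. The plane is read in the
  order (z, y), hence the exchanged arguments.\<close>

lemma kernel_recurrence_mult2_x:
  assumes "kernel_recurrence X"
  shows "X (- 1 - int n) q r = mult2 scale (binpow 1 1 (int n)) (\<lambda>r q. X (- 1) q r) r q"
proof (induction n arbitrary: q r)
  case (Suc n)
  have "X (- 1 - int (Suc n)) q r = X (- 1 - int n) (q - 1) r + X (- 1 - int n) q (r - 1)"
    using kernel_recurrenceD[OF assms, of "- 1 - int n" q r] by (simp add: algebra_simps)
  then show ?case unfolding Suc mult2_binpow_Suc[OF one_neq_zero] by simp
qed (simp add: mult2_binpow_0)

text \<open>Lowering the exponent of z by one multiplies a plane by x - y.\<close>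

lemma kernel_recurrence_mult2_z:
  assumes "kernel_recurrence X"
  shows "X p q (- 1 - int n) = mult2 scale (binpow 1 (- 1) (int n)) (\<lambda>p q. X p q (- 1)) p q"
proof (induction n arbitrary: p q)
  case (Suc n)
  have "X p q (- 1 - int (Suc n)) = X (p - 1) q (- 1 - int n) - X p (q - 1) (- 1 - int n)"
    using kernel_recurrenceD[OF assms, of p q "- 1 - int n"] by (simp add: algebra_simps)
  moreover have "(- 1 :: 'k) \<noteq> 0" by simp
  note mult2_binpow_Suc[OF this]
  ultimately show ?case unfolding Suc by simp
qed (simp add: mult2_binpow_0)

text \<open>\<open>G\<close> takes the kernel's exponent \<open>m\<close> first, so its indices are
  those of (y, x), (x, y) and (z, y) for \<open>kernel_x\<close>, \<open>kernel_y\<close> and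
  \<open>kernel_z\<close>.\<close>

definition delta_prod where
  "delta_prod c G p q r = Sum_any (\<lambda>m. scale (c m p q r) (G m (p + q + r + 1 - m)))"

lemma finite_delta_prod:
  assumes "jacobi_kernel c" "lower_bounded G"
  shows "finite {m. scale (c m p q r) (G m (t m)) \<noteq> 0}"
proof -
  obtain N where N: "\<And>m. m < N \<Longrightarrow> G m = 0" using assms(2) by (auto simp: lower_bounded_def)
  have "{m. scale (c m p q r) (G m (t m)) \<noteq> 0} \<subseteq> {N..max p (max q r)}"
  proof
    fix m assume "m \<in> {m. scale (c m p q r) (G m (t m)) \<noteq> 0}"
    then have m: "c m p q r \<noteq> 0" "G m (t m) \<noteq> 0" by auto
    have "N \<le> m" using m(2) N[of m] by (cases "m < N") auto
    moreover have "m \<le> max p (max q r)"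
      using m(1) assms(1) unfolding jacobi_kernel_def by (meson not_le)
    ultimately show "m \<in> {N..max p (max q r)}" by simp
  qed
  then show ?thesis by (rule finite_subset) simp
qed

text \<open>The three points of the recurrence have the same total degree, hence meet the same
  coefficients of \<open>G\<close>, and the recurrence of the kernel carries over.\<close>

lemma kernel_recurrence_delta_prod:
  assumes "jacobi_kernel c" "lower_bounded G"
  shows "kernel_recurrence (delta_prod c G)"
  unfolding kernel_recurrence_def
proof (intro allI)
  fix p q r
  have "c m (p - 1) q r = c m p (q - 1) r + c m p q (r - 1)" for m
    using assms(1) by (auto simp: jacobi_kernel_def kernel_recurrence_def)
  then show "delta_prod c G (p - 1) q r = delta_prod c G p (q - 1) r + delta_prod c G p q (r - 1)"
    using Sum_any.distrib[OF finite_delta_prod[OF assms] finite_delta_prod[OF assms],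
        of p "q - 1" r "\<lambda>m. p + q + r - m" p q "r - 1" "\<lambda>m. p + q + r - m"]
    by (simp add: delta_prod_def scale_left_distrib algebra_simps)
qed

lemma delta_prod_add:
  assumes "jacobi_kernel c" "lower_bounded G" "lower_bounded H"
  shows "delta_prod c (\<lambda>m t. G m t + H m t) p q r = delta_prod c G p q r + delta_prod c H p q r"
  unfolding delta_prod_def scale_right_distrib
  by (intro Sum_any.distrib finite_delta_prod assms)

lemma delta_prod_scale:
  assumes "jacobi_kernel c" "lower_bounded G"
  shows "delta_prod c (\<lambda>m t. scale k (G m t)) p q r = scale k (delta_prod c G p q r)"
  unfolding delta_prod_def
  by (subst Sum_any_hom[OF finite_delta_prod[OF assms], where S = UNIV and h = "scale k"])
    (auto simp: scale_right_distrib mult.commute)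

lemma delta_prod_eq_0:
  assumes "\<And>m. c m p q r = 0 \<or> G m = 0"
  shows "delta_prod c G p q r = 0"
proof -
  have "scale (c m p q r) (G m t) = 0" for m t using assms[of m] by auto
  then show ?thesis by (simp only: delta_prod_def) (simp add: Sum_any.expand_set)
qed

lemma delta_prod_x_minus_1_z: "delta_prod kernel_x G p q (- 1) = G q p"
  by (simp add: delta_prod_def kernel_x_minus_1_z if_distrib[of "\<lambda>x. scale x _"] cong: if_cong)

lemma delta_prod_y_minus_1_z: "delta_prod kernel_y G p q (- 1) = G p q"
  by (simp add: delta_prod_def kernel_y_minus_1_z if_distrib[of "\<lambda>x. scale x _"] cong: if_cong)

lemma delta_prod_z_minus_1_x: "delta_prod kernel_z G (- 1) q r = G r q"
  by (simp add: delta_prod_def kernel_z_minus_1_x if_distrib[of "\<lambda>x. scale x _"] cong: if_cong)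

text \<open>Y(a, z + y) F(y) is the residue in x of \<delta>(x - y, z) Y(a, x) F(y).\<close>

lemma act_shift_eq_delta_prod:
  "act_shift scale Y a F i j = delta_prod kernel_x (\<lambda>m. Y a (F m)) (- 1) j i"
  by (simp add: act_shift_def delta_prod_def subst_series_eq vector_space_axioms kernel_x_minus_1_x
      algebra_simps)

text \<open>The substitution \<open>m = r + l\<close> makes \<open>l\<close> the exponent of y, as
  in the sum over \<open>D i l\<close> defining the action on \<open>Vhom\<close>.\<close>

lemma delta_prod_y_minus_1_x:
  "delta_prod kernel_y G (- 1) q r =
    Sum_any (\<lambda>l. scale (binpow 1 1 (r + l) r l - binpow 1 1 (r + l) l r) (G (r + l) (q - l)))"
  unfolding delta_prod_def
  by (subst Sum_any_shift[of _ r]) (simp add: kernel_y_minus_1_x algebra_simps)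

lemma delta_prod_z_minus_1_z:
  "delta_prod kernel_z G p q (- 1) =
    Sum_any (\<lambda>l. scale (binpow 1 (- 1) (p + l) p l - binpow (- 1) 1 (p + l) l p) (G (p + l) (q - l)))"
  unfolding delta_prod_def
  by (subst Sum_any_shift[of _ p]) (simp add: kernel_z_minus_1_z algebra_simps)

text \<open>\<open>h1\<close>, \<open>h2\<close>, \<open>h3\<close> are the exponents taken from the
  delta series. Its homogeneity and the constancy of the other factor in one variable determine them
  by a single \<open>m\<close>.\<close>

lemma mult3_delta_prod:
  assumes K: "\<And>m. C (h1 m) (h2 m) (h3 m) = c m p q r"
    and S: "\<And>m. S (p - h1 m) (q - h2 m) (r - h3 m) = G m (p + q + r + 1 - m)"
    and inj: "inj (\<lambda>m. (h1 m, h2 m, h3 m))"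
    and supp: "\<And>i j l. C i j l \<noteq> 0 \<Longrightarrow> S (p - i) (q - j) (r - l) \<noteq> 0 \<Longrightarrow>
      \<exists>m. (i, j, l) = (h1 m, h2 m, h3 m)"
  shows "mult3 scale C S p q r = delta_prod c G p q r"
proof -
  have "mult3 scale C S p q r =
      Sum_any (\<lambda>m. case (h1 m, h2 m, h3 m) of (i, j, l) \<Rightarrow> scale (C i j l) (S (p - i) (q - j) (r - l)))"
    unfolding mult3_def
  proof (rule Sum_any_reindex_inj[OF inj])
    fix x
    assume "(case x of (i, j, l) \<Rightarrow> scale (C i j l) (S (p - i) (q - j) (r - l))) \<noteq> 0"
    then have "\<exists>m. x = (h1 m, h2 m, h3 m)"
      using supp by (cases x) auto
    then show "x \<in> range (\<lambda>m. (h1 m, h2 m, h3 m))" by blast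
  qed
  then show ?thesis by (simp add: delta_prod_def K S)
qed

lemma mult3_delta_x:
  "mult3 scale (\<lambda>p q r. delta 1 (- 1) p q r) (\<lambda>p q r. const_series (G q p) r) p q r =
    delta_prod kernel_x G p q r"
  by (rule mult3_delta_prod[where ?h1.0 = "\<lambda>m. m - q - r - 1" and ?h2.0 = "\<lambda>m. q - m" and ?h3.0 = "\<lambda>m. r"])
    (auto simp: delta_def kernel_x_def const_series_def algebra_simps binpow_def intro!: injI exI[of _ "q - _"]
      split: if_splits)

lemma mult3_delta_y:
  "mult3 scale (\<lambda>p q r. delta (- 1) 1 q p r) (\<lambda>p q r. const_series (G p q) r) p q r =
    delta_prod kernel_y G p q r"
  by (rule mult3_delta_prod[where ?h2.0 = "\<lambda>m. m - p - r - 1" and ?h1.0 = "\<lambda>m. p - m" and ?h3.0 = "\<lambda>m. r"])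
    (auto simp: delta_def kernel_y_def const_series_def algebra_simps binpow_def intro!: injI exI[of _ "p - _"]
      split: if_splits)

lemma mult3_delta_z:
  "mult3 scale (\<lambda>p q r. delta 1 (- 1) p r q) (\<lambda>p q r. const_series (G r q) p) p q r =
    delta_prod kernel_z G p q r"
  by (rule mult3_delta_prod[where ?h2.0 = "\<lambda>m. m - p - r - 1" and ?h1.0 = "\<lambda>m. p" and ?h3.0 = "\<lambda>m. r - m"])
    (auto simp: delta_def kernel_z_def const_series_def algebra_simps binpow_def intro!: injI exI[of _ "r - _"]
      split: if_splits)

text \<open>\<open>A\<close>, \<open>B\<close>, \<open>C\<close> stand for the coefficients of a_x
  I_y(u, v), I_y(u, a_x v) and I_y(a_z u, v), indexed as in \<open>delta_prod\<close>.\<close>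

definition jacobi_defect ::
  "(int \<Rightarrow> int \<Rightarrow> 'a) \<Rightarrow> (int \<Rightarrow> int \<Rightarrow> 'a) \<Rightarrow> (int \<Rightarrow> int \<Rightarrow> 'a) \<Rightarrow> int \<Rightarrow> int \<Rightarrow> int \<Rightarrow> 'a" where
  "jacobi_defect A B C p q r = delta_prod kernel_x A p q r - delta_prod kernel_y B p q r - delta_prod kernel_z C p q r"

definition jacobi_identity where
  "jacobi_identity A B C \<longleftrightarrow> (\<forall>p q r. jacobi_defect A B C p q r = 0)"

lemma jacobi_identity_0: "jacobi_identity 0 0 0"
  by (simp add: jacobi_identity_def jacobi_defect_def delta_prod_eq_0)

lemma jacobi_identity_add:
  assumes "lower_bounded A" "lower_bounded B" "lower_bounded C" "jacobi_identity A B C"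
    and "lower_bounded A'" "lower_bounded B'" "lower_bounded C'" "jacobi_identity A' B' C'"
  shows "jacobi_identity (\<lambda>m t. A m t + A' m t) (\<lambda>m t. B m t + B' m t) (\<lambda>m t. C m t + C' m t)"
proof -
  have "jacobi_defect (\<lambda>m t. A m t + A' m t) (\<lambda>m t. B m t + B' m t) (\<lambda>m t. C m t + C' m t) p q r =
      jacobi_defect A B C p q r + jacobi_defect A' B' C' p q r" for p q r
    unfolding jacobi_defect_def
    by (subst (1 2 3) delta_prod_add) (simp_all add: assms jacobi_kernel_x jacobi_kernel_y jacobi_kernel_z)
  then show ?thesis using assms(4,8) by (simp add: jacobi_identity_def)
qed

lemma jacobi_identity_scale:
  assumes "lower_bounded A" "lower_bounded B" "lower_bounded C" "jacobi_identity A B C"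
  shows "jacobi_identity (\<lambda>m t. scale c (A m t)) (\<lambda>m t. scale c (B m t)) (\<lambda>m t. scale c (C m t))"
proof -
  have "jacobi_defect (\<lambda>m t. scale c (A m t)) (\<lambda>m t. scale c (B m t)) (\<lambda>m t. scale c (C m t)) p q r =
      scale c (jacobi_defect A B C p q r)" for p q r
    unfolding jacobi_defect_def scale_right_diff_distrib
    by (subst (1 2 3) delta_prod_scale) (simp_all add: assms jacobi_kernel_x jacobi_kernel_y jacobi_kernel_z)
  then show ?thesis using assms(4) by (simp add: jacobi_identity_def)
qed

text \<open>\<open>A\<close> is indexed by (y, x), hence the exchange in
  \<open>A j i\<close>.\<close>

definition weak_commutativity where
  "weak_commutativity k A B \<longleftrightarrow>
    mult2 scale (binpow 1 (- 1) (int k)) (\<lambda>i j. A j i) = mult2 scale (binpow 1 (- 1) (int k)) B"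

text \<open>By \<open>act_shift_eq_delta_prod\<close> the residue on the left is a_(z+y) I_y(u, v)
  when \<open>A\<close> is the family of a_x I_y(u, v).\<close>

definition weak_associativity where
  "weak_associativity n A C \<longleftrightarrow>
    mult2 scale (binpow 1 1 (int n)) (\<lambda>i j. delta_prod kernel_x A (- 1) j i) =
    mult2 scale (binpow 1 1 (int n)) C"

section \<open>The Jacobi identity against weak commutativity and weak associativity\<close>

context
  fixes A B C :: "int \<Rightarrow> int \<Rightarrow> 'a"
  assumes A: "lower_bounded A" and B: "lower_bounded B" and C: "lower_bounded C"
begin

lemmas delta_prod_recurrences =
  kernel_recurrence_delta_prod[OF jacobi_kernel_x A] kernel_recurrence_delta_prod[OF jacobi_kernel_y B]
  kernel_recurrence_delta_prod[OF jacobi_kernel_z C]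

text \<open>The planes z^-1 of the two products are \<open>A\<close>, with indices exchanged, and
  \<open>B\<close>; passing to z^(-1-k) multiplies both by (x - y)^k.\<close>

lemma weak_commutativity_iff:
  "weak_commutativity k A B \<longleftrightarrow>
    (\<forall>p q. delta_prod kernel_x A p q (- 1 - int k) = delta_prod kernel_y B p q (- 1 - int k))"
  unfolding weak_commutativity_def kernel_recurrence_mult2_z[OF delta_prod_recurrences(1)]
    kernel_recurrence_mult2_z[OF delta_prod_recurrences(2)] delta_prod_x_minus_1_z delta_prod_y_minus_1_z
  by (simp only: fun_eq_iff)

text \<open>The plane x^-1 of the third product is \<open>C\<close>; passing to x^(-1-n) multiplies
  by (z + y)^n.\<close>

lemma weak_associativity_iff:
  "weak_associativity n A C \<longleftrightarrow>
    (\<forall>q r. delta_prod kernel_x A (- 1 - int n) q r = delta_prod kernel_z C (- 1 - int n) q r)"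
  unfolding weak_associativity_def kernel_recurrence_mult2_x[OF delta_prod_recurrences(1)]
    kernel_recurrence_mult2_x[OF delta_prod_recurrences(3)] delta_prod_z_minus_1_x
  unfolding fun_eq_iff by blast

lemma jacobi_identity_plane:
  assumes P: "\<And>q r. jacobi_defect A B C P q r = 0" and R: "\<And>p q. jacobi_defect A B C p q R = 0"
  shows "jacobi_identity A B C"
proof -
  have "kernel_recurrence (jacobi_defect A B C)"
    unfolding jacobi_defect_def[abs_def] by (intro kernel_recurrence_diff delta_prod_recurrences)
  from kernel_recurrence_zero[OF this P R] show ?thesis by (simp add: jacobi_identity_def)
qed

lemma jacobi_imp_weak_commutativity:
  assumes "jacobi_identity A B C" and zero: "\<And>m. m \<le> - 1 - int k \<Longrightarrow> C m = 0"
  shows "weak_commutativity k A B"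
proof -
  \<comment> \<open>\<open>kernel_z\<close> needs \<open>m \<le> r\<close>, and \<open>C m\<close>
    is 0 for all such \<open>m\<close> at \<open>r = - 1 - int k\<close>.\<close>
  have "delta_prod kernel_z C p q (- 1 - int k) = 0" for p q
    by (rule delta_prod_eq_0) (metis kernel_z_eq_0 zero not_le)
  then show ?thesis using assms(1)
    by (simp add: weak_commutativity_iff jacobi_identity_def jacobi_defect_def diff_eq_eq)
qed

lemma jacobi_imp_weak_associativity:
  assumes "jacobi_identity A B C" and zero: "\<And>m. m \<le> - 1 - int n \<Longrightarrow> B m = 0"
  shows "weak_associativity n A C"
proof -
  have "delta_prod kernel_y B (- 1 - int n) q r = 0" for q r
    by (rule delta_prod_eq_0) (metis kernel_y_eq_0 zero not_le)
  then show ?thesis using assms(1)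
    by (simp add: weak_associativity_iff jacobi_identity_def jacobi_defect_def diff_eq_eq)
qed

lemma weak_commutativity_imp_plane:
  assumes "weak_commutativity k A B"
  shows "\<exists>R. \<forall>p q. jacobi_defect A B C p q R = 0"
proof -
  obtain N where N: "\<And>m. m < N \<Longrightarrow> C m = 0" using C by (auto simp: lower_bounded_def)
  \<comment> \<open>Below \<open>N\<close> the third term vanishes. The first two agree at
    \<open>- 1 - int k\<close>, and this agreement propagates downwards.\<close>
  define R where "R = min (N - 1) (- 1 - int k)"
  have "delta_prod kernel_z C p q R = 0" for p q
    by (rule delta_prod_eq_0) (use N kernel_z_eq_0[of R] in \<open>force simp: R_def\<close>)
  moreover have "delta_prod kernel_x A p q R - delta_prod kernel_y B p q R = 0" for p q
    by (rule kernel_recurrence_zero_z[OF kernel_recurrence_diff[OF delta_prod_recurrences(1,2)]])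
      (use assms in \<open>auto simp: weak_commutativity_iff R_def\<close>)
  ultimately have "\<forall>p q. jacobi_defect A B C p q R = 0" by (simp add: jacobi_defect_def)
  then show ?thesis ..
qed

lemma weak_associativity_imp_plane:
  assumes "weak_associativity n A C"
  shows "\<exists>P. \<forall>q r. jacobi_defect A B C P q r = 0"
proof -
  obtain N where N: "\<And>m. m < N \<Longrightarrow> B m = 0" using B by (auto simp: lower_bounded_def)
  \<comment> \<open>As for \<open>R\<close>, but in x, with \<open>B\<close> as the term that
    vanishes.\<close>
  define P where "P = min (N - 1) (- 1 - int n)"
  have "delta_prod kernel_y B P q r = 0" for q r
    by (rule delta_prod_eq_0) (use N kernel_y_eq_0[of P] in \<open>force simp: P_def\<close>)
  moreover have "delta_prod kernel_x A P q r - delta_prod kernel_z C P q r = 0" for q r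
    by (rule kernel_recurrence_zero_x[OF kernel_recurrence_diff[OF delta_prod_recurrences(1,3)]])
      (use assms in \<open>auto simp: weak_associativity_iff P_def\<close>)
  ultimately have "\<forall>q r. jacobi_defect A B C P q r = 0" by (simp add: jacobi_defect_def)
  then show ?thesis ..
qed

end

end

section \<open>Modules and vertex bilinear maps\<close>

lemma laurent_series_lower_bounded: "F \<in> laurent_series S \<Longrightarrow> lower_bounded F"
  by (auto simp: laurent_series_def lower_bounded_def)

lemma laurent_series_mem: "F \<in> laurent_series S \<Longrightarrow> F n \<in> S"
  by (auto simp: laurent_series_def)

lemma lower_bounded_comp:
  "lower_bounded F \<Longrightarrow> h 0 = 0 \<Longrightarrow> lower_bounded (\<lambda>n. h (F n))"
  unfolding lower_bounded_def by metis

lemma lower_bounded_nat: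
  assumes "lower_bounded F"
  obtains k :: nat where "\<And>m. m \<le> - 1 - int k \<Longrightarrow> F m = 0"
proof -
  obtain N where N: "\<forall>m<N. F m = 0" using assms by (auto simp: lower_bounded_def)
  have "F m = 0" if "m \<le> - 1 - int (nat (- N))" for m
  proof -
    have "m < N" using that by linarith
    then show ?thesis using N by blast
  qed
  then show ?thesis by (rule that)
qed

lemma laurent_series_add:
  assumes "\<And>x y. x \<in> S \<Longrightarrow> y \<in> S \<Longrightarrow> x + y \<in> S" "F \<in> laurent_series S" "G \<in> laurent_series S"
  shows "F + (G :: int \<Rightarrow> 'a::monoid_add) \<in> laurent_series S"
proof -
  obtain N N' where "\<forall>n<N. F n = 0" "\<forall>n<N'. G n = 0"
    using assms by (auto simp: laurent_series_def)
  then have "\<forall>n<min N N'. (F + G) n = 0" by simp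
  then have "\<exists>N. \<forall>n<N. (F + G) n = 0" ..
  then show ?thesis using assms by (simp add: laurent_series_def image_subset_iff)
qed

lemma laurent_series_map:
  assumes "\<And>x. x \<in> S \<Longrightarrow> h x \<in> S'" "h 0 = 0" "F \<in> laurent_series S"
  shows "(\<lambda>n. h (F n)) \<in> laurent_series S'"
proof -
  obtain N where "\<forall>n<N. F n = 0" using assms(3) by (auto simp: laurent_series_def)
  then have "\<forall>n<N. h (F n) = 0" using assms(2) by simp
  then have "\<exists>N. \<forall>n<N. h (F n) = 0" ..
  then show ?thesis using assms by (simp add: laurent_series_def image_subset_iff)
qed

locale vmodule =
  fixes V :: "('k::{alg_closed_field, field_char_0}, 'v::ab_group_add) valg"
    and M :: "('k, 'v, 'm::ab_group_add) vmod"
  assumes vertex_module: "vertex_module V M"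
begin

sublocale formal_space "scl M"
  using vertex_module by (simp add: vertex_module_def Let_def formal_space_def)

lemma subspace_carr: "subspace (carr M)"
  using vertex_module by (simp add: vertex_module_def Let_def)

lemmas carr_0 = subspace_0[OF subspace_carr]
  and carr_add = subspace_add[OF subspace_carr]
  and carr_diff = subspace_diff[OF subspace_carr]
  and carr_scale = subspace_scale[OF subspace_carr]

lemma der_carr: "u \<in> carr M \<Longrightarrow> der M u \<in> carr M"
  and der_linear: "linear_on (scl M) (scl M) (carr M) (der M)"
  and act_bilinear: "bilinear_laurent (vscale V) UNIV (scl M) (carr M) (scl M) (carr M) (act M)"
  using vertex_module by (auto simp: vertex_module_def Let_def)

lemma act_laurent: "u \<in> carr M \<Longrightarrow> act M a u \<in> laurent_series (carr M)"
  and act_linear: "linear_on (scl M) (fscale (scl M)) (carr M) (act M a)"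
  using act_bilinear by (auto simp: bilinear_laurent_def)

lemmas act_carr = laurent_series_mem[OF act_laurent]
  and act_lower_bounded = laurent_series_lower_bounded[OF act_laurent]
  and act_0 = linear_on_0[OF act_linear carr_0]
  and der_0 = linear_on_0[OF der_linear carr_0]
  and act_add = linear_on_add[OF act_linear]
  and der_add = linear_on_add[OF der_linear]
  and der_scale = linear_on_scale[OF der_linear]

lemma act_scale: "u \<in> carr M \<Longrightarrow> act M a (scl M c u) n = scl M c (act M a u n)"
  using linear_on_scale[OF act_linear] by (simp add: fscale_def)

end

section \<open>Intertwining operators and vertex bilinear maps\<close>

locale vmodule_triple =
  M: vmodule V M + N: vmodule V N + W: vmodule V W
  for V :: "('k::{alg_closed_field, field_char_0}, 'v::ab_group_add) valg"
    and M :: "('k, 'v, 'm::ab_group_add) vmod"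
    and N :: "('k, 'v, 'n::ab_group_add) vmod"
    and W :: "('k, 'v, 'w::ab_group_add) vmod"
begin

abbreviation "act_out F a u v \<equiv> \<lambda>m. act W a (F u v m)"
abbreviation "act_right F a u v \<equiv> \<lambda>m. F u (act N a v m)"
abbreviation "act_left F a u v \<equiv> \<lambda>m. F (act M a u m) v"

definition translation_covariant :: "('m \<Rightarrow> 'n \<Rightarrow> int \<Rightarrow> 'w) \<Rightarrow> bool" where
  "translation_covariant F \<longleftrightarrow> (\<forall>u\<in>carr M. \<forall>v\<in>carr N.
     F (der M u) v = deriv_series (scl W) (F u v) \<and>
     F u (der N v) = (\<lambda>n. der W (F u v n)) - deriv_series (scl W) (F u v))"

definition jacobi where
  "jacobi F a u v \<longleftrightarrow> W.jacobi_identity (act_out F a u v) (act_right F a u v) (act_left F a u v)"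

text \<open>Once F(du, v) is the derivative of F(u, v), the two forms of the condition on
  \<open>d\<close> are rearrangements of each other.\<close>

lemma intertwining_iff:
  "F \<in> intertwining M N W \<longleftrightarrow> F \<in> bilinear_maps M N W \<and> translation_covariant F \<and>
    (\<forall>a. \<forall>u\<in>carr M. \<forall>v\<in>carr N. jacobi F a u v)"
proof -
  have "(F (der M u) v = deriv_series (scl W) (F u v) \<and>
        (\<forall>n. der W (F u v n) = F (der M u) v n + F u (der N v) n)) \<longleftrightarrow>
      (F (der M u) v = deriv_series (scl W) (F u v) \<and>
        F u (der N v) = (\<lambda>n. der W (F u v n)) - deriv_series (scl W) (F u v))" for u v
    by (auto simp: fun_eq_iff algebra_simps)
  then show ?thesis
    by (auto simp: intertwining_def translation_covariant_def jacobi_def W.jacobi_identity_def W.jacobi_defect_def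
      W.mult3_delta_x[symmetric, where G = "act_out F _ _ _"] W.mult3_delta_y[symmetric]
      W.mult3_delta_z[symmetric, where G = "act_left F _ _ _"] fun_eq_iff)
qed

lemma vertex_bilinear_iff:
  "F \<in> vertex_bilinear M N W \<longleftrightarrow> F \<in> bilinear_maps M N W \<and> translation_covariant F \<and>
    (\<forall>a. \<forall>u\<in>carr M. \<forall>v\<in>carr N. \<exists>n k.
      W.weak_associativity n (act_out F a u v) (act_left F a u v) \<and>
      W.weak_commutativity k (act_out F a u v) (act_right F a u v))"
  unfolding vertex_bilinear_def translation_covariant_def W.weak_associativity_def
    W.weak_commutativity_def W.act_shift_eq_delta_prod[symmetric]
  by blast

context
  fixes F
  assumes F: "F \<in> bilinear_maps M N W"
begin

lemma bilinear_eq_0: "u \<notin> carr M \<or> v \<notin> carr N \<Longrightarrow> F u v = 0"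
  and bilinear_laurent: "u \<in> carr M \<Longrightarrow> v \<in> carr N \<Longrightarrow> F u v \<in> laurent_series (carr W)"
  and linear_left: "v \<in> carr N \<Longrightarrow> linear_on (scl M) (fscale (scl W)) (carr M) (\<lambda>u. F u v)"
  and linear_right: "u \<in> carr M \<Longrightarrow> linear_on (scl N) (fscale (scl W)) (carr N) (F u)"
  using F by (auto simp: bilinear_maps_def bilinear_laurent_def)

lemma bilinear_0_left: "F 0 v = 0"
  using linear_on_0[OF linear_left M.carr_0] bilinear_eq_0 by blast

lemma bilinear_0_right: "F u 0 = 0"
  using linear_on_0[OF linear_right N.carr_0] bilinear_eq_0 by blast

lemma
  assumes u: "u \<in> carr M" and v: "v \<in> carr N"
  shows lower_bounded_out: "lower_bounded (act_out F a u v)"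
    and lower_bounded_right: "lower_bounded (act_right F a u v)"
    and lower_bounded_left: "lower_bounded (act_left F a u v)"
  using laurent_series_lower_bounded[OF bilinear_laurent[OF u v]] N.act_lower_bounded[OF v, of a]
    M.act_lower_bounded[OF u, of a]
  by (auto intro!: lower_bounded_comp simp: W.act_0 bilinear_0_left bilinear_0_right
      intro: lower_bounded_comp[where h = "\<lambda>x. F x v"])

text \<open>The order is the pole order of \<open>act M a u\<close>, hence independent of
  \<open>v\<close>, as the carrier of \<open>Vhom\<close> demands.\<close>

lemma jacobi_imp_uniform_weak_commutativity:
  assumes "\<And>v. v \<in> carr N \<Longrightarrow> jacobi F a u v" and u: "u \<in> carr M"
  shows "\<exists>k. \<forall>v\<in>carr N. W.weak_commutativity k (act_out F a u v) (act_right F a u v)"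
proof -
  obtain k where k: "\<And>m. m \<le> - 1 - int k \<Longrightarrow> act M a u m = 0"
    using lower_bounded_nat[OF M.act_lower_bounded[OF u, of a]] by blast
  have "W.weak_commutativity k (act_out F a u v) (act_right F a u v)" if v: "v \<in> carr N" for v
    using assms(1)[OF v] k unfolding jacobi_def
    by (intro W.jacobi_imp_weak_commutativity[OF lower_bounded_out[OF u v] lower_bounded_right[OF u v]
          lower_bounded_left[OF u v]]) (auto simp: bilinear_0_left)
  then show ?thesis by blast
qed

text \<open>The order comes from \<open>act N a v\<close> and so is independent of \<open>u\<close>,
  as the carrier of \<open>Vhom_r\<close> demands.\<close>

lemma jacobi_imp_uniform_weak_associativity:
  assumes "\<And>u. u \<in> carr M \<Longrightarrow> jacobi F a u v" and v: "v \<in> carr N"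
  shows "\<exists>n. \<forall>u\<in>carr M. W.weak_associativity n (act_out F a u v) (act_left F a u v)"
proof -
  obtain n where n: "\<And>m. m \<le> - 1 - int n \<Longrightarrow> act N a v m = 0"
    using lower_bounded_nat[OF N.act_lower_bounded[OF v, of a]] by blast
  have "W.weak_associativity n (act_out F a u v) (act_left F a u v)" if u: "u \<in> carr M" for u
    using assms(1)[OF u] n unfolding jacobi_def
    by (intro W.jacobi_imp_weak_associativity[OF lower_bounded_out[OF u v] lower_bounded_right[OF u v]
          lower_bounded_left[OF u v]]) (auto simp: bilinear_0_right)
  then show ?thesis by blast
qed

lemma jacobi_plane:
  assumes "u \<in> carr M" "v \<in> carr N"
    and "\<And>q r. W.jacobi_defect (act_out F a u v) (act_right F a u v) (act_left F a u v) P q r = 0"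
    and "\<And>p q. W.jacobi_defect (act_out F a u v) (act_right F a u v) (act_left F a u v) p q R = 0"
  shows "jacobi F a u v"
  unfolding jacobi_def using assms(3,4)
  by (intro W.jacobi_identity_plane[OF lower_bounded_out[OF assms(1,2)] lower_bounded_right[OF assms(1,2)]
        lower_bounded_left[OF assms(1,2)]])

lemma
  assumes uv: "u \<in> carr M" "v \<in> carr N"
  shows commutativity_plane: "W.weak_commutativity k (act_out F a u v) (act_right F a u v) \<Longrightarrow>
      \<exists>R. \<forall>p q. W.jacobi_defect (act_out F a u v) (act_right F a u v) (act_left F a u v) p q R = 0"
    and associativity_plane: "W.weak_associativity n (act_out F a u v) (act_left F a u v) \<Longrightarrow>
      \<exists>P. \<forall>q r. W.jacobi_defect (act_out F a u v) (act_right F a u v) (act_left F a u v) P q r = 0"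
  using W.weak_commutativity_imp_plane[OF lower_bounded_out[OF uv] lower_bounded_right[OF uv] lower_bounded_left[OF uv]]
    W.weak_associativity_imp_plane[OF lower_bounded_out[OF uv] lower_bounded_right[OF uv] lower_bounded_left[OF uv]]
  by blast+

end

text \<open>Conversely, associativity yields a zero plane of the defect in x and commutativity one
  in z, and two such planes force the identity.\<close>

lemma intertwining_eq_vertex_bilinear: "intertwining M N W = vertex_bilinear M N W"
proof (intro set_eqI iffI)
  fix F assume "F \<in> intertwining M N W"
  then show "F \<in> vertex_bilinear M N W"
    unfolding intertwining_iff vertex_bilinear_iff
    using jacobi_imp_uniform_weak_commutativity jacobi_imp_uniform_weak_associativity by meson
next
  fix F assume *: "F \<in> vertex_bilinear M N W"
  then have F: "F \<in> bilinear_maps M N W" by (simp add: vertex_bilinear_iff)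
  have "jacobi F a u v" if uv: "u \<in> carr M" "v \<in> carr N" for a u v
  proof -
    obtain n k where "W.weak_associativity n (act_out F a u v) (act_left F a u v)"
      "W.weak_commutativity k (act_out F a u v) (act_right F a u v)"
      using * uv unfolding vertex_bilinear_iff by blast
    then show ?thesis
      using associativity_plane[OF F uv] commutativity_plane[OF F uv]
        jacobi_plane[OF F uv] by meson
  qed
  then show "F \<in> intertwining M N W"
    using * by (simp add: intertwining_iff vertex_bilinear_iff)
qed

section \<open>Curried maps into the modules \<open>Vhom\<close> and \<open>Vhom_r\<close>\<close>

lemma act_Vhom:
  assumes F: "F \<in> bilinear_maps M N W" and u: "u \<in> carr M" and v: "v \<in> carr N"
  shows "act (Vhom N W) a (F u) i v j =
    W.delta_prod kernel_x (act_out F a u v) (- 1) j i - W.delta_prod kernel_y (act_right F a u v) (- 1) j i"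
proof -
  \<comment> \<open>Both expansions involve only the coefficient of exponent \<open>i + l\<close>,
    so their difference is \<open>?K l\<close> times one vector, and linearity of \<open>F u\<close>
    applies.\<close>
  let ?K = "\<lambda>l. binpow 1 1 (i + l) i l - binpow 1 1 (i + l) l i :: 'k"
  have "F u (subst_series (scl N) 1 1 (act N a v) i l - subst_series (scl N) 1 1 (act N a v) l i) =
      fscale (scl W) (?K l) (F u (act N a v (i + l)))" for l
    using linear_on_scale[OF linear_right[OF F u] N.act_carr[OF v]]
    by (simp add: subst_series_eq[OF N.vector_space_axioms] N.scale_left_diff_distrib[symmetric] add.commute[of l i])
  then show ?thesis
    using v by (simp add: Vhom_def Let_def W.act_shift_eq_delta_prod W.delta_prod_y_minus_1_x fscale_def)
qed

lemma act_Vhom_r: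
  assumes F: "F \<in> bilinear_maps M N W" and u: "u \<in> carr M" and v: "v \<in> carr N"
  shows "act (Vhom_r M W) a (\<lambda>u. F u v) i u j =
    W.delta_prod kernel_x (act_out F a u v) i j (- 1) - W.delta_prod kernel_z (act_left F a u v) i j (- 1)"
proof -
  let ?K = "\<lambda>l. binpow 1 (- 1) (i + l) i l - binpow (- 1) 1 (i + l) l i :: 'k"
  have "F (subst_series (scl M) 1 (- 1) (act M a u) i l - subst_series (scl M) (- 1) 1 (act M a u) l i) v =
      fscale (scl W) (?K l) (F (act M a u (i + l)) v)" for l
    using linear_on_scale[OF linear_left[OF F v] M.act_carr[OF u]]
    by (simp add: subst_series_eq[OF M.vector_space_axioms] M.scale_left_diff_distrib[symmetric] add.commute[of l i])
  then show ?thesis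
    using u by (simp add: Vhom_r_def Let_def W.delta_prod_x_minus_1_z W.delta_prod_z_minus_1_z fscale_def)
qed

lemma act_Vhom_eq_0: "v \<notin> carr N \<Longrightarrow> act (Vhom N W) a f i v j = 0"
  by (simp add: Vhom_def)

lemma act_Vhom_r_eq_0: "u \<notin> carr M \<Longrightarrow> act (Vhom_r M W) a f i u j = 0"
  by (simp add: Vhom_r_def)

lemma bilinear_mapsI:
  assumes "\<And>u v. u \<notin> carr M \<or> v \<notin> carr N \<Longrightarrow> F u v = 0"
    and "\<And>u v. u \<in> carr M \<Longrightarrow> v \<in> carr N \<Longrightarrow> F u v \<in> laurent_series (carr W)"
    and "\<And>u u' v. u \<in> carr M \<Longrightarrow> u' \<in> carr M \<Longrightarrow> v \<in> carr N \<Longrightarrow> F (u + u') v = F u v + F u' v"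
    and "\<And>c u v n. u \<in> carr M \<Longrightarrow> v \<in> carr N \<Longrightarrow> F (scl M c u) v n = scl W c (F u v n)"
    and "\<And>u v v'. u \<in> carr M \<Longrightarrow> v \<in> carr N \<Longrightarrow> v' \<in> carr N \<Longrightarrow> F u (v + v') = F u v + F u v'"
    and "\<And>c u v n. u \<in> carr M \<Longrightarrow> v \<in> carr N \<Longrightarrow> F u (scl N c v) n = scl W c (F u v n)"
  shows "F \<in> bilinear_maps M N W"
  using assms unfolding bilinear_maps_def bilinear_laurent_def linear_on_def fscale_def fun_eq_iff mem_Collect_eq
  by (intro conjI allI impI ballI; simp)

lemma
  assumes "F \<in> bilinear_maps M N W" "u \<in> carr M" "v \<in> carr N"
  shows bilinear_add_left: "u' \<in> carr M \<Longrightarrow> F (u + u') v = F u v + F u' v"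
    and bilinear_scale_left: "F (scl M c u) v n = scl W c (F u v n)"
    and bilinear_add_right: "v' \<in> carr N \<Longrightarrow> F u (v + v') = F u v + F u v'"
    and bilinear_scale_right: "F u (scl N c v) n = scl W c (F u v n)"
  using linear_left[OF assms(1,3)] linear_right[OF assms(1,2)] assms(2,3)
  by (simp_all add: linear_on_def fscale_def)

text \<open>Membership of \<open>F u\<close> in \<open>Vhom\<close> supplies linearity in
  \<open>v\<close>, Laurent values and zeros off \<open>carr N\<close>; the homomorphism property
  supplies linearity in \<open>u\<close> and zeros off \<open>carr M\<close>.\<close>

lemma vHom_Vhom_bilinear:
  assumes "F \<in> vHom M (Vhom N W)"
  shows "F \<in> bilinear_maps M N W"
proof -
  have out: "F u = 0" if "u \<notin> carr M" for u
    using assms that by (simp add: vHom_def)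
  have mem: "F u \<in> linear_laurent_maps N W" if "u \<in> carr M" for u
    using assms that by (auto simp: vHom_def Vhom_def Pi_iff)
  have out': "F u v = 0" if "u \<notin> carr M \<or> v \<notin> carr N" for u v
    using out[of u] mem[of u] that by (cases "u \<in> carr M") (auto simp: linear_laurent_maps_def)
  have "linear_on (scl M) (fscale (fscale (scl W))) (carr M) F"
    using assms by (simp add: vHom_def Vhom_def)
  then show ?thesis
    using out' mem unfolding linear_on_def linear_laurent_maps_def mem_Collect_eq
    by (intro bilinear_mapsI) (auto simp: fscale_def Pi_iff)
qed

lemma vHom_Vhom_r_bilinear:
  assumes "(\<lambda>v u. F u v) \<in> vHom N (Vhom_r M W)"
  shows "F \<in> bilinear_maps M N W"
proof -
  have out: "(\<lambda>u. F u v) = 0" if "v \<notin> carr N" for v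
    using assms that by (simp add: vHom_def)
  have mem: "(\<lambda>u. F u v) \<in> linear_laurent_maps M W" if "v \<in> carr N" for v
    using assms that by (auto simp: vHom_def Vhom_r_def Pi_iff)
  have out': "F u v = 0" if "u \<notin> carr M \<or> v \<notin> carr N" for u v
    using out[of v, THEN fun_cong, of u] mem[of v] that
    by (cases "v \<in> carr N") (auto simp: linear_laurent_maps_def)
  have "linear_on (scl N) (fscale (fscale (scl W))) (carr N) (\<lambda>v u. F u v)"
    using assms by (simp add: vHom_def Vhom_r_def)
  then show ?thesis
    using out' mem unfolding linear_on_def linear_laurent_maps_def mem_Collect_eq fun_eq_iff
    by (intro bilinear_mapsI) (auto simp: fscale_def Pi_iff fun_eq_iff)
qed

context
  fixes F
  assumes F: "F \<in> bilinear_maps M N W"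
begin

text \<open>The carrier of \<open>Vhom\<close> accounts for the derivation law in \<open>v\<close>
  and for commutativity, the homomorphism property for the law in \<open>u\<close> and for the plane
  x^-1: there the third term is \<open>F (act M a u r) v q\<close>, and the other two form the
  action on \<open>Vhom\<close>.\<close>

lemma vHom_Vhom_iff:
  "F \<in> vHom M (Vhom N W) \<longleftrightarrow> translation_covariant F \<and>
    (\<forall>a. \<forall>u\<in>carr M. \<exists>k. \<forall>v\<in>carr N. W.weak_commutativity k (act_out F a u v) (act_right F a u v)) \<and>
    (\<forall>a. \<forall>u\<in>carr M. \<forall>v\<in>carr N. \<forall>q r.
      W.jacobi_defect (act_out F a u v) (act_right F a u v) (act_left F a u v) (- 1) q r = 0)"
    (is "_ \<longleftrightarrow> _ \<and> ?comm \<and> ?act")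
proof -
  note zero = bilinear_eq_0[OF F]
  have 1: "(\<forall>u. u \<notin> carr M \<longrightarrow> F u = 0) \<and> linear_on (scl M) (scl (Vhom N W)) (carr M) F"
    using zero linear_left[OF F]
    by (auto simp: Vhom_def linear_on_def fscale_def fun_eq_iff)
      (metis zero_fun_apply add.right_neutral W.scale_zero_right)+
  have 2: "F \<in> carr M \<rightarrow> carr (Vhom N W) \<longleftrightarrow>
      (\<forall>u\<in>carr M. \<forall>v\<in>carr N. F u (der N v) = (\<lambda>n. der W (F u v n)) - deriv_series (scl W) (F u v)) \<and> ?comm"
    using zero bilinear_laurent[OF F] linear_right[OF F]
    by (auto simp: Vhom_def linear_laurent_maps_def W.weak_commutativity_def Pi_iff)
  have 3: "(\<forall>a. \<forall>u\<in>carr M. \<forall>n. F (act M a u n) = act (Vhom N W) a (F u) n) \<longleftrightarrow> ?act"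
  proof -
    have "F (act M a u n) = act (Vhom N W) a (F u) n \<longleftrightarrow> (\<forall>v\<in>carr N. \<forall>q.
        W.jacobi_defect (act_out F a u v) (act_right F a u v) (act_left F a u v) (- 1) q n = 0)"
      if u: "u \<in> carr M" for a u n
    proof -
      have "F (act M a u n) v q = act (Vhom N W) a (F u) n v q \<longleftrightarrow>
          W.jacobi_defect (act_out F a u v) (act_right F a u v) (act_left F a u v) (- 1) q n = 0"
        if "v \<in> carr N" for v q
        unfolding act_Vhom[OF F u that] W.jacobi_defect_def W.delta_prod_z_minus_1_x by (auto simp: algebra_simps)
      moreover have "F (act M a u n) v q = act (Vhom N W) a (F u) n v q" if "v \<notin> carr N" for v q
        using that zero by (simp add: act_Vhom_eq_0)
      ultimately show ?thesis unfolding fun_eq_iff by blast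
    qed
    then show ?thesis by blast
  qed
  have 4: "(\<forall>u\<in>carr M. F (der M u) = der (Vhom N W) (F u)) \<longleftrightarrow>
      (\<forall>u\<in>carr M. \<forall>v\<in>carr N. F (der M u) v = deriv_series (scl W) (F u v))"
    using zero by (auto simp: Vhom_def fun_eq_iff)
  have 5: "translation_covariant F \<longleftrightarrow>
      (\<forall>u\<in>carr M. \<forall>v\<in>carr N. F (der M u) v = deriv_series (scl W) (F u v)) \<and>
      (\<forall>u\<in>carr M. \<forall>v\<in>carr N. F u (der N v) = (\<lambda>n. der W (F u v n)) - deriv_series (scl W) (F u v))"
    unfolding translation_covariant_def by blast
  show ?thesis
    using 1 unfolding vHom_def mem_Collect_eq 2 3 4 5 by argo
qed

text \<open>Here the carrier accounts for the law in \<open>u\<close> and associativity, and the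
  action concerns the plane z^-1, where the second term is
  \<open>F u (act N a v p) q\<close>.\<close>

lemma vHom_Vhom_r_iff:
  "(\<lambda>v u. F u v) \<in> vHom N (Vhom_r M W) \<longleftrightarrow> translation_covariant F \<and>
    (\<forall>a. \<forall>v\<in>carr N. \<exists>n. \<forall>u\<in>carr M. W.weak_associativity n (act_out F a u v) (act_left F a u v)) \<and>
    (\<forall>a. \<forall>u\<in>carr M. \<forall>v\<in>carr N. \<forall>p q.
      W.jacobi_defect (act_out F a u v) (act_right F a u v) (act_left F a u v) p q (- 1) = 0)"
    (is "?G \<in> _ \<longleftrightarrow> _ \<and> ?assoc \<and> ?act")
proof -
  note zero = bilinear_eq_0[OF F]
  have 1: "(\<forall>v. v \<notin> carr N \<longrightarrow> ?G v = 0) \<and> linear_on (scl N) (scl (Vhom_r M W)) (carr N) ?G"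
    using zero linear_right[OF F]
    by (auto simp: Vhom_r_def linear_on_def fscale_def fun_eq_iff)
      (metis zero_fun_apply add.right_neutral W.scale_zero_right)+
  have 2: "?G \<in> carr N \<rightarrow> carr (Vhom_r M W) \<longleftrightarrow>
      (\<forall>u\<in>carr M. \<forall>v\<in>carr N. F (der M u) v = deriv_series (scl W) (F u v)) \<and> ?assoc"
    using zero bilinear_laurent[OF F] linear_left[OF F]
    by (auto simp: Vhom_r_def linear_laurent_maps_def W.weak_associativity_def W.act_shift_eq_delta_prod[symmetric] Pi_iff)
  have 3: "(\<forall>a. \<forall>v\<in>carr N. \<forall>n. ?G (act N a v n) = act (Vhom_r M W) a (?G v) n) \<longleftrightarrow> ?act"
  proof -
    have "?G (act N a v p) = act (Vhom_r M W) a (?G v) p \<longleftrightarrow> (\<forall>u\<in>carr M. \<forall>q.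
        W.jacobi_defect (act_out F a u v) (act_right F a u v) (act_left F a u v) p q (- 1) = 0)"
      if v: "v \<in> carr N" for a v p
    proof -
      have "F u (act N a v p) q = act (Vhom_r M W) a (?G v) p u q \<longleftrightarrow>
          W.jacobi_defect (act_out F a u v) (act_right F a u v) (act_left F a u v) p q (- 1) = 0"
        if "u \<in> carr M" for u q
        unfolding act_Vhom_r[OF F that v] W.jacobi_defect_def W.delta_prod_y_minus_1_z by (auto simp: algebra_simps)
      moreover have "F u (act N a v p) q = act (Vhom_r M W) a (?G v) p u q" if "u \<notin> carr M" for u q
        using that zero by (simp add: act_Vhom_r_eq_0)
      ultimately show ?thesis unfolding fun_eq_iff by blast
    qed
    then show ?thesis by blast
  qed
  have 4: "(\<forall>v\<in>carr N. ?G (der N v) = der (Vhom_r M W) (?G v)) \<longleftrightarrow>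
      (\<forall>u\<in>carr M. \<forall>v\<in>carr N. F u (der N v) = (\<lambda>n. der W (F u v n)) - deriv_series (scl W) (F u v))"
    using zero by (auto simp: Vhom_r_def fun_eq_iff)
  have 5: "translation_covariant F \<longleftrightarrow>
      (\<forall>u\<in>carr M. \<forall>v\<in>carr N. F (der M u) v = deriv_series (scl W) (F u v)) \<and>
      (\<forall>u\<in>carr M. \<forall>v\<in>carr N. F u (der N v) = (\<lambda>n. der W (F u v n)) - deriv_series (scl W) (F u v))"
    unfolding translation_covariant_def by blast
  show ?thesis
    using 1 unfolding vHom_def mem_Collect_eq 2 3 4 5 by argo
qed

end

text \<open>The action condition is a zero plane of the defect in x, and commutativity provides one
  in z.\<close>

lemma vHom_Vhom_eq_intertwining: "vHom M (Vhom N W) = intertwining M N W"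
proof (intro set_eqI iffI)
  fix F assume *: "F \<in> vHom M (Vhom N W)"
  then have F: "F \<in> bilinear_maps M N W" by (rule vHom_Vhom_bilinear)
  have "jacobi F a u v" if uv: "u \<in> carr M" "v \<in> carr N" for a u v
  proof -
    obtain k where "W.weak_commutativity k (act_out F a u v) (act_right F a u v)"
      using * uv unfolding vHom_Vhom_iff[OF F] by blast
    then show ?thesis
      using commutativity_plane[OF F uv] jacobi_plane[OF F uv] * uv unfolding vHom_Vhom_iff[OF F] by meson
  qed
  then show "F \<in> intertwining M N W"
    using * F by (simp add: intertwining_iff vHom_Vhom_iff)
next
  fix F assume *: "F \<in> intertwining M N W"
  then have F: "F \<in> bilinear_maps M N W" by (simp add: intertwining_iff)
  show "F \<in> vHom M (Vhom N W)"
    unfolding vHom_Vhom_iff[OF F]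
    using * jacobi_imp_uniform_weak_commutativity[OF F]
    unfolding intertwining_iff jacobi_def W.jacobi_identity_def by meson
qed

text \<open>Now the action condition is a zero plane in z, and associativity provides one in
  x.\<close>

lemma vHom_Vhom_r_iff_intertwining:
  "(\<lambda>v u. F u v) \<in> vHom N (Vhom_r M W) \<longleftrightarrow> F \<in> intertwining M N W"
proof
  assume *: "(\<lambda>v u. F u v) \<in> vHom N (Vhom_r M W)"
  then have F: "F \<in> bilinear_maps M N W" by (rule vHom_Vhom_r_bilinear)
  have "jacobi F a u v" if uv: "u \<in> carr M" "v \<in> carr N" for a u v
  proof -
    obtain n where "W.weak_associativity n (act_out F a u v) (act_left F a u v)"
      using * uv unfolding vHom_Vhom_r_iff[OF F] by blast
    then show ?thesis
      using associativity_plane[OF F uv] jacobi_plane[OF F uv] * uv unfolding vHom_Vhom_r_iff[OF F] by meson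
  qed
  then show "F \<in> intertwining M N W"
    using * F by (simp add: intertwining_iff vHom_Vhom_r_iff)
next
  assume *: "F \<in> intertwining M N W"
  then have F: "F \<in> bilinear_maps M N W" by (simp add: intertwining_iff)
  show "(\<lambda>v u. F u v) \<in> vHom N (Vhom_r M W)"
    unfolding vHom_Vhom_r_iff[OF F]
    using * jacobi_imp_uniform_weak_associativity[OF F]
    unfolding intertwining_iff jacobi_def W.jacobi_identity_def by meson
qed

lemma vHom_Vhom_r_eq_image: "vHom N (Vhom_r M W) = (\<lambda>F v u. F u v) ` intertwining M N W"
proof (intro equalityI subsetI)
  fix G assume "G \<in> vHom N (Vhom_r M W)"
  then show "G \<in> (\<lambda>F v u. F u v) ` intertwining M N W"
    using vHom_Vhom_r_iff_intertwining[of "\<lambda>u v. G v u"] by (intro image_eqI[of _ _ "\<lambda>u v. G v u"]) simp_all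
qed (auto simp: vHom_Vhom_r_iff_intertwining)

section \<open>Linear structure on the intertwining operators\<close>

lemma bilinear_maps_closed:
  "0 \<in> bilinear_maps M N W"
  "F \<in> bilinear_maps M N W \<Longrightarrow> G \<in> bilinear_maps M N W \<Longrightarrow> F + G \<in> bilinear_maps M N W"
  "F \<in> bilinear_maps M N W \<Longrightarrow> fscale (fscale (fscale (scl W))) c F \<in> bilinear_maps M N W"
proof -
  show "0 \<in> bilinear_maps M N W"
    by (rule bilinear_mapsI) (auto simp: laurent_series_def W.carr_0)
next
  assume F: "F \<in> bilinear_maps M N W" and G: "G \<in> bilinear_maps M N W"
  show "F + G \<in> bilinear_maps M N W"
    by (rule bilinear_mapsI)
      (auto simp: bilinear_eq_0[OF F] bilinear_eq_0[OF G] bilinear_add_left[OF F] bilinear_add_left[OF G]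
        bilinear_add_right[OF F] bilinear_add_right[OF G] bilinear_scale_left[OF F] bilinear_scale_left[OF G]
        bilinear_scale_right[OF F] bilinear_scale_right[OF G] W.scale_right_distrib algebra_simps
        intro!: laurent_series_add[OF W.carr_add] bilinear_laurent[OF F] bilinear_laurent[OF G])
next
  assume F: "F \<in> bilinear_maps M N W"
  have scaled: "(\<lambda>n. scl W c (F u v n)) \<in> laurent_series (carr W)"
    if "u \<in> carr M" "v \<in> carr N" for u v
    by (rule laurent_series_map[where h = "scl W c", OF _ _ bilinear_laurent[OF F that]])
      (simp_all add: W.carr_scale)
  then show "fscale (fscale (fscale (scl W))) c F \<in> bilinear_maps M N W"
    by (intro bilinear_mapsI)
      (auto simp: fscale_def fun_eq_iff bilinear_eq_0[OF F] bilinear_add_left[OF F] bilinear_add_right[OF F]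
        bilinear_scale_left[OF F] bilinear_scale_right[OF F] W.scale_right_distrib mult.commute)
qed

lemma subspace_intertwining:
  "module.subspace (fscale (fscale (fscale (scl W)))) (intertwining M N W)"
  unfolding subspace_iff[OF vector_space_fscale[OF vector_space_fscale[OF vector_space_fscale[OF W.vector_space_axioms]]]]
proof (intro conjI ballI allI)
  have modes: "act_out 0 a u v = 0" "act_right 0 a u v = 0" "act_left 0 a u v = 0" for a u v
    by (auto simp: fun_eq_iff W.act_0)
  have "jacobi 0 a u v" for a u v
    unfolding jacobi_def modes by (rule W.jacobi_identity_0)
  moreover have "translation_covariant 0"
    by (simp add: translation_covariant_def fun_eq_iff deriv_series_def W.der_0)
  ultimately show "0 \<in> intertwining M N W"
    by (simp add: intertwining_iff bilinear_maps_closed)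
next
  fix F G assume *: "F \<in> intertwining M N W" "G \<in> intertwining M N W"
  then have F: "F \<in> bilinear_maps M N W" and G: "G \<in> bilinear_maps M N W"
    and cov: "translation_covariant F" "translation_covariant G"
    by (simp_all add: intertwining_iff)
  note mem = laurent_series_mem[OF bilinear_laurent[OF F]] laurent_series_mem[OF bilinear_laurent[OF G]]
  have "jacobi (F + G) a u v" if uv: "u \<in> carr M" "v \<in> carr N" for a u v
  proof -
    have modes: "act_out (F + G) a u v = (\<lambda>m t. act_out F a u v m t + act_out G a u v m t)"
      "act_right (F + G) a u v = (\<lambda>m t. act_right F a u v m t + act_right G a u v m t)"
      "act_left (F + G) a u v = (\<lambda>m t. act_left F a u v m t + act_left G a u v m t)"
      by (auto simp: fun_eq_iff W.act_add mem[OF uv])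
    show ?thesis
      using * uv unfolding jacobi_def modes intertwining_iff
      by (intro W.jacobi_identity_add lower_bounded_out lower_bounded_right lower_bounded_left) blast+
  qed
  moreover have "translation_covariant (F + G)"
    unfolding translation_covariant_def
  proof (intro ballI conjI ext)
    fix u v n assume uv: "u \<in> carr M" "v \<in> carr N"
    note eqs = bspec[OF bspec[OF cov(1)[unfolded translation_covariant_def] uv(1)] uv(2)]
      bspec[OF bspec[OF cov(2)[unfolded translation_covariant_def] uv(1)] uv(2)]
    show "(F + G) (der M u) v n = deriv_series (scl W) ((F + G) u v) n"
      using eqs by (simp add: deriv_series_def W.scale_right_distrib)
    show "(F + G) u (der N v) n = ((\<lambda>n. der W ((F + G) u v n)) - deriv_series (scl W) ((F + G) u v)) n"
      using eqs by (simp add: deriv_series_def W.scale_right_distrib W.der_add mem[OF uv])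
  qed
  ultimately show "F + G \<in> intertwining M N W"
    using F G by (simp add: intertwining_iff bilinear_maps_closed)
next
  fix c F assume *: "F \<in> intertwining M N W"
  then have F: "F \<in> bilinear_maps M N W" and cov: "translation_covariant F"
    by (simp_all add: intertwining_iff)
  note mem = laurent_series_mem[OF bilinear_laurent[OF F]]
  let ?F = "fscale (fscale (fscale (scl W))) c F"
  have "jacobi ?F a u v" if uv: "u \<in> carr M" "v \<in> carr N" for a u v
  proof -
    have modes: "act_out ?F a u v = (\<lambda>m t. scl W c (act_out F a u v m t))"
      "act_right ?F a u v = (\<lambda>m t. scl W c (act_right F a u v m t))"
      "act_left ?F a u v = (\<lambda>m t. scl W c (act_left F a u v m t))"
      by (auto simp: fun_eq_iff fscale_def W.act_scale mem[OF uv])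
    show ?thesis
      using * uv unfolding jacobi_def modes intertwining_iff
      by (intro W.jacobi_identity_scale lower_bounded_out lower_bounded_right lower_bounded_left) blast+
  qed
  moreover have "translation_covariant ?F"
    unfolding translation_covariant_def
  proof (intro ballI conjI ext)
    fix u v n assume uv: "u \<in> carr M" "v \<in> carr N"
    note eqs = bspec[OF bspec[OF cov[unfolded translation_covariant_def] uv(1)] uv(2)]
    show "?F (der M u) v n = deriv_series (scl W) (?F u v) n"
      using eqs by (simp add: deriv_series_def fscale_def mult.commute)
    show "?F u (der N v) n = ((\<lambda>n. der W (?F u v n)) - deriv_series (scl W) (?F u v)) n"
      using eqs by (simp add: deriv_series_def fscale_def W.scale_right_diff_distrib W.der_scale mem[OF uv] mult.commute)
  qed
  ultimately show "?F \<in> intertwining M N W"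
    using F by (simp add: intertwining_iff bilinear_maps_closed)
qed

end

section \<open>Homomorphisms\<close>

locale vmodule_pair = M: vmodule V M + W: vmodule V W
  for V :: "('k::{alg_closed_field, field_char_0}, 'v::ab_group_add) valg"
    and M :: "('k, 'v, 'm::ab_group_add) vmod"
    and W :: "('k, 'v, 'w::ab_group_add) vmod"
begin

lemma
  assumes "\<phi> \<in> vHom M W"
  shows vHom_carr: "u \<in> carr M \<Longrightarrow> \<phi> u \<in> carr W"
    and vHom_linear: "linear_on (scl M) (scl W) (carr M) \<phi>"
    and vHom_act: "u \<in> carr M \<Longrightarrow> \<phi> (act M a u n) = act W a (\<phi> u) n"
    and vHom_der: "u \<in> carr M \<Longrightarrow> \<phi> (der M u) = der W (\<phi> u)"
    and vHom_out: "u \<notin> carr M \<Longrightarrow> \<phi> u = 0"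
  using assms by (auto simp: vHom_def)

lemmas vHom_0 = linear_on_0[OF vHom_linear M.carr_0]
  and vHom_add = linear_on_add[OF vHom_linear]
  and vHom_scale = linear_on_scale[OF vHom_linear]

lemma vHom_diff:
  assumes "\<phi> \<in> vHom M W" "x \<in> carr M" "y \<in> carr M"
  shows "\<phi> (x - y) = \<phi> x - \<phi> y"
  using vHom_add[OF assms(1) M.carr_diff[OF assms(2,3)] assms(3)] by (simp add: eq_diff_eq)

lemma subspace_vHom: "module.subspace (fscale (scl W)) (vHom M W)"
  unfolding subspace_iff[OF vector_space_fscale[OF W.vector_space_axioms]]
proof (intro conjI ballI allI)
  show "0 \<in> vHom M W"
    by (auto simp: vHom_def linear_on_def W.carr_0 W.act_0 W.der_0)
next
  fix \<phi> \<psi> assume \<phi>: "\<phi> \<in> vHom M W" and \<psi>: "\<psi> \<in> vHom M W"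
  show "\<phi> + \<psi> \<in> vHom M W"
    using vHom_carr[OF \<phi>] vHom_carr[OF \<psi>]
    by (auto simp: vHom_def linear_on_def vHom_out[OF \<phi>] vHom_out[OF \<psi>] vHom_add[OF \<phi>] vHom_add[OF \<psi>]
        vHom_scale[OF \<phi>] vHom_scale[OF \<psi>] vHom_act[OF \<phi>] vHom_act[OF \<psi>] vHom_der[OF \<phi>] vHom_der[OF \<psi>]
        W.carr_add W.act_add W.der_add W.scale_right_distrib)
next
  fix c \<phi> assume \<phi>: "\<phi> \<in> vHom M W"
  show "fscale (scl W) c \<phi> \<in> vHom M W"
    using vHom_carr[OF \<phi>]
    by (auto simp: vHom_def linear_on_def fscale_def vHom_out[OF \<phi>] vHom_add[OF \<phi>] vHom_scale[OF \<phi>]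
        vHom_act[OF \<phi>] vHom_der[OF \<phi>] W.carr_scale W.act_scale W.der_scale W.scale_right_distrib mult.commute)
qed

lemma delta_prod_carr: "(\<And>m n. G m n \<in> carr M) \<Longrightarrow> M.delta_prod c G p q r \<in> carr M"
  unfolding M.delta_prod_def Sum_any.expand_set by (intro M.subspace_sum M.subspace_carr M.carr_scale)

lemma vHom_delta_prod:
  assumes \<phi>: "\<phi> \<in> vHom M W" and "jacobi_kernel c" "lower_bounded G" and G: "\<And>m n. G m n \<in> carr M"
  shows "\<phi> (M.delta_prod c G p q r) = W.delta_prod c (\<lambda>m n. \<phi> (G m n)) p q r"
  unfolding M.delta_prod_def W.delta_prod_def
  by (subst Sum_any_hom[OF M.finite_delta_prod[OF assms(2,3)], where S = "carr M" and h = \<phi>])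
    (simp_all add: G M.carr_scale M.carr_0 M.carr_add vHom_add[OF \<phi>] vHom_scale[OF \<phi>])

lemma vHom_jacobi_identity:
  assumes \<phi>: "\<phi> \<in> vHom M W" and "M.jacobi_identity A B C"
    and lb: "lower_bounded A" "lower_bounded B" "lower_bounded C"
    and mem: "\<And>m n. A m n \<in> carr M" "\<And>m n. B m n \<in> carr M" "\<And>m n. C m n \<in> carr M"
  shows "W.jacobi_identity (\<lambda>m n. \<phi> (A m n)) (\<lambda>m n. \<phi> (B m n)) (\<lambda>m n. \<phi> (C m n))"
proof -
  have "W.jacobi_defect (\<lambda>m n. \<phi> (A m n)) (\<lambda>m n. \<phi> (B m n)) (\<lambda>m n. \<phi> (C m n)) p q r =
      \<phi> (M.jacobi_defect A B C p q r)" for p q r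
    unfolding W.jacobi_defect_def M.jacobi_defect_def
    by (simp add: vHom_diff[OF \<phi>] delta_prod_carr mem M.carr_diff vHom_delta_prod[OF \<phi>] lb
        jacobi_kernel_x jacobi_kernel_y jacobi_kernel_z)
  then show ?thesis
    using assms(2) by (simp add: M.jacobi_identity_def W.jacobi_identity_def vHom_0[OF \<phi>])
qed

end

text \<open>Delta products are finite sums inside the carrier, so \<phi> commutes with them and maps
  the Jacobi identity in \<open>T\<close> to the one in \<open>W\<close>.\<close>

lemma vHom_comp_intertwining:
  assumes "vertex_module V M" "vertex_module V N" "vertex_module V T" "vertex_module V W"
    and \<phi>: "\<phi> \<in> vHom T W" and F: "F \<in> intertwining M N T"
  shows "(\<lambda>u v n. \<phi> (F u v n)) \<in> intertwining M N W"
proof -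
  interpret T: vmodule_triple V M N T by unfold_locales fact+
  interpret W: vmodule_triple V M N W by unfold_locales fact+
  interpret H: vmodule_pair V T W by unfold_locales
  have F': "F \<in> bilinear_maps M N T" and cov: "T.translation_covariant F"
    using F by (simp_all add: T.intertwining_iff)
  note mem = laurent_series_mem[OF T.bilinear_laurent[OF F']]
  note hom = H.vHom_0[OF \<phi>] H.vHom_add[OF \<phi>] H.vHom_scale[OF \<phi>]
    H.vHom_diff[OF \<phi>] H.vHom_act[OF \<phi>] H.vHom_der[OF \<phi>]
  let ?F = "\<lambda>u v n. \<phi> (F u v n)"
  have laurent: "?F u v \<in> laurent_series (carr W)" if "u \<in> carr M" "v \<in> carr N" for u v
    by (rule laurent_series_map[where h = \<phi>, OF _ _ T.bilinear_laurent[OF F' that]])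
      (simp_all add: H.vHom_carr[OF \<phi>] hom)
  have "?F \<in> bilinear_maps M N W"
    by (rule W.bilinear_mapsI)
      (auto simp: laurent T.bilinear_eq_0[OF F'] T.bilinear_add_left[OF F'] T.bilinear_add_right[OF F']
        T.bilinear_scale_left[OF F'] T.bilinear_scale_right[OF F'] hom mem fun_eq_iff)
  moreover have "W.translation_covariant ?F"
    unfolding W.translation_covariant_def
  proof (intro ballI conjI ext)
    fix u v n assume uv: "u \<in> carr M" "v \<in> carr N"
    note eqs = bspec[OF bspec[OF cov[unfolded T.translation_covariant_def] uv(1)] uv(2)]
    show "?F (der M u) v n = deriv_series (scl W) (?F u v) n"
      using eqs by (simp add: deriv_series_def hom mem[OF uv])
    show "?F u (der N v) n = ((\<lambda>n. der W (?F u v n)) - deriv_series (scl W) (?F u v)) n"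
      using eqs by (simp add: deriv_series_def hom mem[OF uv] T.W.der_carr T.W.carr_scale)
  qed
  moreover have "W.jacobi ?F a u v" if uv: "u \<in> carr M" "v \<in> carr N" for a u v
  proof -
    \<comment> \<open>Only this family involves the action on the target, where \<phi> has to be
      moved past \<open>a\<close>.\<close>
    have out: "W.act_out ?F a u v = (\<lambda>m n. \<phi> (T.act_out F a u v m n))"
      by (simp add: hom mem[OF uv] fun_eq_iff)
    have "T.jacobi F a u v" using F uv by (simp add: T.intertwining_iff)
    then show ?thesis
      unfolding W.jacobi_def T.jacobi_def out
      by (rule H.vHom_jacobi_identity[OF \<phi> _ T.lower_bounded_out[OF F' uv] T.lower_bounded_right[OF F' uv]
            T.lower_bounded_left[OF F' uv]])
        (simp_all add: T.W.act_carr mem uv T.M.act_carr T.N.act_carr)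
  qed
  ultimately show ?thesis by (simp add: W.intertwining_iff)
qed

section \<open>The universal property and the chain of isomorphisms\<close>

theorem corollary5p15:
  fixes V :: "('k::{alg_closed_field, field_char_0}, 'v::ab_group_add) valg"
    and M :: "('k, 'v, 'm::ab_group_add) vmod"
    and N :: "('k, 'v, 'n::ab_group_add) vmod"
    and W :: "('k, 'v, 'w::ab_group_add) vmod"
    and T :: "('k, 'v, 't::ab_group_add) vmod"
    and tens :: "'m \<Rightarrow> 'n \<Rightarrow> int \<Rightarrow> 't"
  assumes "vertex_algebra V"
    and "vertex_module V M" and "vertex_module V N" and "vertex_module V W"
    and "is_tensor_product TYPE('w) V M N T tens"
  shows "linearly_isomorphic
           (fscale (fscale (fscale (scl W)))) (intertwining M N W)
           (fscale (fscale (fscale (scl W)))) (vertex_bilinear M N W) \<and>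
         linearly_isomorphic
           (fscale (fscale (fscale (scl W)))) (vertex_bilinear M N W)
           (fscale (scl W)) (vHom T W) \<and>
         linearly_isomorphic
           (fscale (scl W)) (vHom T W)
           (fscale (scl (Vhom N W))) (vHom M (Vhom N W)) \<and>
         linearly_isomorphic
           (fscale (scl (Vhom N W))) (vHom M (Vhom N W))
           (fscale (scl (Vhom_r M W))) (vHom N (Vhom_r M W))"
proof -
  have T: "vertex_module V T" and tens: "tens \<in> vertex_bilinear M N T"
    and univ: "\<And>I. I \<in> vertex_bilinear M N W \<Longrightarrow>
      \<exists>!\<phi>. \<phi> \<in> vHom T W \<and> (\<forall>u\<in>carr M. \<forall>v\<in>carr N. \<forall>n. I u v n = \<phi> (tens u v n))"
    using assms(4,5) by (auto simp: is_tensor_product_def)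
  interpret T: vmodule_triple V M N T by unfold_locales fact+
  interpret W: vmodule_triple V M N W by unfold_locales fact+
  interpret H: vmodule_pair V T W by unfold_locales
  let ?s = "fscale (fscale (fscale (scl W)))" and ?X = "intertwining M N W"
  have s: "vector_space ?s" "vector_space (fscale (scl W))"
    by (intro vector_space_fscale W.W.vector_space_axioms)+
  have tens': "tens \<in> bilinear_maps M N T" using tens by (simp add: T.vertex_bilinear_iff)

  have "linearly_isomorphic (fscale (scl W)) (vHom T W) ?s ((\<lambda>\<phi> u v n. \<phi> (tens u v n)) ` vHom T W)"
  proof (rule linearly_isomorphic_image[OF s(2) s(1) H.subspace_vHom])
    show "linear_on (fscale (scl W)) ?s (vHom T W) (\<lambda>\<phi> u v n. \<phi> (tens u v n))"
      by (simp add: linear_on_def fscale_def fun_eq_iff)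
    show "inj_on (\<lambda>\<phi> u v n. \<phi> (tens u v n)) (vHom T W)"
    proof (rule inj_onI)
      fix \<phi> \<psi> assume \<phi>: "\<phi> \<in> vHom T W" and \<psi>: "\<psi> \<in> vHom T W"
        and eq: "(\<lambda>u v n. \<phi> (tens u v n)) = (\<lambda>u v n. \<psi> (tens u v n))"
      \<comment> \<open>Uniqueness in the universal property speaks about vertex bilinear maps, so
        the composite must first be shown to be one.\<close>
      have "(\<lambda>u v n. \<phi> (tens u v n)) \<in> vertex_bilinear M N W"
        using vHom_comp_intertwining[OF assms(2,3) T assms(4) \<phi>] tens
        by (simp add: T.intertwining_eq_vertex_bilinear W.intertwining_eq_vertex_bilinear)
      from univ[OF this] show "\<phi> = \<psi>" using \<phi> \<psi> eq by (metis (no_types, lifting))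
    qed
  qed
  moreover have "(\<lambda>\<phi> u v n. \<phi> (tens u v n)) ` vHom T W = ?X"
  proof (intro equalityI subsetI)
    fix I assume "I \<in> ?X"
    then have I: "I \<in> vertex_bilinear M N W" "I \<in> bilinear_maps M N W"
      by (simp_all add: W.intertwining_eq_vertex_bilinear W.vertex_bilinear_iff)
    obtain \<phi> where \<phi>: "\<phi> \<in> vHom T W" "\<forall>u\<in>carr M. \<forall>v\<in>carr N. \<forall>n. I u v n = \<phi> (tens u v n)"
      using univ[OF I(1)] by blast
    \<comment> \<open>The universal property covers the carriers; elsewhere \<open>I\<close> and
      \<open>tens\<close> are 0 and \<phi> maps 0 to 0.\<close>
    have "I u v n = \<phi> (tens u v n)" for u v n
    proof (cases "u \<in> carr M \<and> v \<in> carr N")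
      case False
      then show ?thesis
        using W.bilinear_eq_0[OF I(2), of u v] T.bilinear_eq_0[OF tens', of u v] H.vHom_0[OF \<phi>(1)] by auto
    qed (use \<phi>(2) in blast)
    then show "I \<in> (\<lambda>\<phi> u v n. \<phi> (tens u v n)) ` vHom T W" using \<phi>(1) by blast
  next
    fix I assume "I \<in> (\<lambda>\<phi> u v n. \<phi> (tens u v n)) ` vHom T W"
    then show "I \<in> ?X"
      using vHom_comp_intertwining[OF assms(2,3) T assms(4)] tens
      by (auto simp: T.intertwining_eq_vertex_bilinear)
  qed
  ultimately have Hom: "linearly_isomorphic (fscale (scl W)) (vHom T W) ?s ?X" by simp
  \<comment> \<open>Exchanging the arguments gives the last link of the chain.\<close>
  have "linearly_isomorphic ?s ?X ?s ((\<lambda>F v u. F u v) ` ?X)"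
  proof (rule linearly_isomorphic_image[OF s(1) s(1) W.subspace_intertwining])
    show "inj_on (\<lambda>F v u. F u v) ?X" by (rule inj_onI) (metis (no_types) ext)
  qed (simp add: linear_on_def fscale_def fun_eq_iff)
  \<comment> \<open>The identity gives the first link. The second and third are \<open>Hom\<close>
    inverted and \<open>Hom\<close> itself, as \<open>?X\<close> equals both
    \<open>vertex_bilinear M N W\<close> and \<open>vHom M (Vhom N W)\<close>.\<close>
  moreover have "linearly_isomorphic ?s ?X ?s ((\<lambda>F. F) ` ?X)"
    by (rule linearly_isomorphic_image[OF s(1) s(1) W.subspace_intertwining]) (simp_all add: linear_on_def)
  moreover have "scl (Vhom N W) = fscale (fscale (scl W))" "scl (Vhom_r M W) = fscale (fscale (scl W))"
    by (simp_all add: Vhom_def Vhom_r_def)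
  ultimately show ?thesis
    using Hom linearly_isomorphic_sym[OF s(2) Hom]
    by (simp add: W.vHom_Vhom_eq_intertwining W.vHom_Vhom_r_eq_image
        W.intertwining_eq_vertex_bilinear[symmetric])
qed

end
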